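(* Let $a$, $b$, and $c$ be indeterminates, and let $k$ be an arbitrary integer. Then $$\sum_{n=-\infty}^{\infty}\frac{(1-aq^{2n})}{(1-a)}\frac{(b,cq^k,aq^{-k}/b;q)_n}{(aq/b,aq^{1-k}/c,bq^{1+k};q)_n}\,q^{\binom n2}\left(-\frac{aq}{c}\right)^n\,(bq^{1+n},bq^{1-n}/a,c^2q^{2+n}/b,c^2q^{2-n}/ab;q^2)_{\infty}$$ $$=\frac{(bc/a,bq,bq/a,b/c;q)_k}{(q,c/a,c,c^2q/a;q)_k}\,\frac{(c^2q/a;q^2)_k}{(b^2q/a;q^2)_k}\left(-\frac{c}{b}\right)^k\cdot\frac{(q,q,aq,q/a,aq/bc,bq/c;q)_{\infty}}{(bq,q/b,bq/a,aq/b,q/c,aq/c;q)_{\infty}}\,(q,b^2q/a,c^2q^2/a,c^2q^2/b^2;q^2)_{\infty}.$$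
   Context: Here $q$ is a fixed complex number with $0<|q|<1$. Notation, for a base $p\in\{q,q^2\}$: $(x;p)_\infty=\prod_{j\ge 0}(1-xp^j)$; for every integer $k$, $(x;p)_k=(x;p)_\infty/(xp^k;p)_\infty$, i.e. $(x;p)_k=\prod_{j=0}^{k-1}(1-xp^j)$ for $k\ge0$ and $(x;p)_{k}=\prod_{j=1}^{-k}(1-xp^{-j})^{-1}$ for $k<0$ (with $1/(q;q)_k=0$ for $k<0$); and $(x_1,\dots,x_m;p)_k=(x_1;p)_k\cdots(x_m;p)_k$ for $k$ an integer or $\infty$. In a parameter such as $aq/bc$ everything after the slash is in the denominator, i.e. $aq/bc=aq/(bc)$. For every integer $n$, $\binom n2=n(n-1)/2$. The indeterminates are understood as nonzero complex numbers in general position (no denominator occurring in the statement vanishes). *)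

theory Defs
  imports "HOL-Analysis.Analysis"
begin

definition qpoch_inf :: "complex \<Rightarrow> complex \<Rightarrow> complex" where
  "qpoch_inf x p = (\<Prod>j. 1 - x * p ^ j)"

text \<open>
  The q-shifted factorial $(x;p)_k$ for an arbitrary integer $k$. For $k < 0$ it is only meaningful
  if no factor $1 - x p^{-j}$ with $1 \le j \le -k$ vanishes. If one does, then the value is $0$ here
  and, since division by $0$ is $0$, so is that of $1/(x;p)_k$. The latter agrees with the
  usual convention for the reciprocal, which is the finite product of these factors; in particular
  $1/(q;q)_k = 0$ for $k < 0$.
\<close>

definition qpoch :: "complex \<Rightarrow> complex \<Rightarrow> int \<Rightarrow> complex" where
  "qpoch x p k =
     (if k \<ge> 0 then \<Prod>j<nat k. 1 - x * p ^ j
      else \<Prod>j=1..nat (- k). inverse (1 - x * p powi (- int j)))"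

definition qpochs :: "complex list \<Rightarrow> complex \<Rightarrow> int \<Rightarrow> complex" where
  "qpochs xs p k = (\<Prod>x\<leftarrow>xs. qpoch x p k)"

definition qpochs_inf :: "complex list \<Rightarrow> complex \<Rightarrow> complex" where
  "qpochs_inf xs p = (\<Prod>x\<leftarrow>xs. qpoch_inf x p)"

text \<open>
  No factor in a denominator of the quotient $(xs;p)_k / (ys;p)_k$ vanishes. For $k \ge 0$ these
  factors come from the parameters \<open>ys\<close>; for $k < 0$ they come from the parameters \<open>xs\<close>, since
  $1/(y;p)_k$ is then a product of factors $1 - y p^{-j}$, which are allowed to vanish.
\<close>

definition qpoch_ratio_defined ::
    "complex list \<Rightarrow> complex list \<Rightarrow> complex \<Rightarrow> int \<Rightarrow> bool" where
  "qpoch_ratio_defined xs ys p k \<longleftrightarrow>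
     (\<forall>y\<in>set ys. \<forall>j\<in>{0..<k}. 1 - y * p powi j \<noteq> 0) \<and>
     (\<forall>x\<in>set xs. \<forall>j\<in>{1..-k}. 1 - x * p powi (- j) \<noteq> 0)"

end

theory Submission
  imports Defs "HOL-Complex_Analysis.Complex_Analysis"
begin

text \<open>
  Choose \<open>\<alpha>\<close> with \<open>\<alpha>\<^sup>2 = a\<close> and put \<open>B = b / \<alpha>\<close>, \<open>C = c / \<alpha>\<close>. A factor that does not depend on the
  summation index turns the summand into \<open>\<alpha>\<^sup>4\<^sup>n q\<^sup>m U(\<alpha> q\<^sup>n)\<close> with \<open>m = 2n\<^sup>2\<close>, where \<open>U(x)\<close>, the
  function \<open>kernel\<close> below, is \<open>x - 1/x\<close> times ten infinite products without denominators and
  changes sign under \<open>x \<mapsto> 1/x\<close> (\<open>summand_eq_kernel_term\<close>). The very-well-poised structure of the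
  series is exactly this symmetry.

  Hence the sum \<open>F(\<alpha>)\<close> with \<open>B\<close> and \<open>C\<close> fixed is holomorphic for \<open>\<alpha> \<noteq> 0\<close>, satisfies
  \<open>F(1/\<alpha>) = -F(\<alpha>)\<close>, and shifting the summation index gives \<open>q\<^sup>2 \<alpha>\<^sup>4 F(q\<alpha>) = F(\<alpha>)\<close>. These two
  relations force \<open>F\<close> to vanish whenever \<open>\<alpha>\<^sup>2\<close> is a power of \<open>q\<close>. At these points the theta function
  \<open>odd_theta\<close>, which satisfies the same relations, has simple zeros, and it has no other zeros. So
  the quotient is a bounded entire function in the logarithm of \<open>\<alpha>\<close>, and Liouville's theorem makes
  it constant (\<open>odd_quasi_periodic_eq_odd_theta\<close>).

  It remains to find this constant as a function of \<open>k\<close>, \<open>B\<close>, \<open>C\<close>. At \<open>\<alpha> = B\<close> all terms of the sum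
  vanish if \<open>k < 0\<close>, and all but one if \<open>k = 0\<close>. From there one climbs in \<open>k\<close>: the kernels with
  parameters \<open>(k+1, B, C)\<close>, \<open>(k, B, C)\<close> and \<open>(k-1, Bq\<^sup>2, Cq)\<close> are a common function times affine functions
  of \<open>x + 1/x\<close>; these are linearly dependent, which yields a three-term recurrence for the
  constants (\<open>kernel_sum_contiguous\<close>). The closed form satisfies the same recurrence
  (\<open>theta_coeff_contiguous\<close>). Both the evaluation at \<open>\<alpha> = B\<close> and the recurrence can degenerate, but
  only for countably many \<open>B\<close>, and these are reached by continuity in \<open>B\<close>.
\<close>

section \<open>Infinite and finite q-shifted factorials\<close>

lemma power_neq_1:
  fixes q :: complex
  assumes "norm q < 1" "0 < n"
  shows "q ^ n \<noteq> 1"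
proof
  assume "q ^ n = 1"
  hence "norm q ^ n = 1" by (metis norm_one norm_power)
  moreover have "norm q ^ n < 1" using assms by (subst power_less_one_iff) auto
  ultimately show False by simp
qed

lemma qpoch_inf_has_prod:
  assumes "norm p < 1"
  shows "(\<lambda>j. 1 - x * p ^ j) has_prod qpoch_inf x p"
proof -
  have "summable (\<lambda>j. norm (- (x * p ^ j)))"
    using assms by (simp add: norm_mult norm_power summable_mult summable_geometric)
  hence "abs_convergent_prod (\<lambda>j. 1 + (- (x * p ^ j)))"
    by (intro summable_imp_abs_convergent_prod) simp
  hence "convergent_prod (\<lambda>j. 1 - x * p ^ j)"
    using abs_convergent_prod_imp_convergent_prod by fastforce
  thus ?thesis unfolding qpoch_inf_def by (rule convergent_prod_has_prod)
qed

lemma qpoch_inf_LIMSEQ: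
  assumes "norm p < 1"
  shows "(\<lambda>N. \<Prod>j<N. 1 - x * p ^ j) \<longlonglongrightarrow> qpoch_inf x p"
  using has_prod_imp_tendsto'[OF qpoch_inf_has_prod[OF assms]] .

lemma qpoch_inf_eq_0_iff:
  assumes "norm p < 1"
  shows "qpoch_inf x p = 0 \<longleftrightarrow> (\<exists>j. x * p ^ j = 1)"
proof -
  have "qpoch_inf x p = 0 \<longleftrightarrow> (\<exists>j. 1 - x * p ^ j = 0)"
    unfolding has_prod_eq_0_iff[OF qpoch_inf_has_prod[OF assms, of x]] by fastforce
  thus ?thesis by simp
qed

lemma qpoch_inf_self_neq_0:
  assumes "norm p < 1"
  shows "qpoch_inf p p \<noteq> 0"
  using power_neq_1[OF assms, of "Suc _"] qpoch_inf_eq_0_iff[OF assms, of p] by auto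

lemma qpoch_inf_step:
  assumes "norm p < 1"
  shows "qpoch_inf x p = (1 - x) * qpoch_inf (x * p) p"
proof (rule LIMSEQ_unique)
  show "(\<lambda>N. \<Prod>j<Suc N. 1 - x * p ^ j) \<longlonglongrightarrow> qpoch_inf x p"
    using qpoch_inf_LIMSEQ[OF assms] by (rule LIMSEQ_Suc)
  have "(\<lambda>N. (1 - x) * (\<Prod>j<N. 1 - (x * p) * p ^ j)) \<longlonglongrightarrow> (1 - x) * qpoch_inf (x * p) p"
    by (intro tendsto_intros qpoch_inf_LIMSEQ assms)
  thus "(\<lambda>N. \<Prod>j<Suc N. 1 - x * p ^ j) \<longlonglongrightarrow> (1 - x) * qpoch_inf (x * p) p"
    by (simp only: prod.lessThan_Suc_shift) (simp add: mult.assoc)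
qed

lemma qpoch_inf_holomorphic_UNIV:
  assumes "norm p < 1"
  shows "(\<lambda>x. qpoch_inf x p) holomorphic_on UNIV"
proof (rule holomorphic_uniform_sequence[OF open_UNIV])
  fix N :: nat
  show "(\<lambda>x. \<Prod>j<N. 1 - x * p ^ j) holomorphic_on UNIV"
    by (intro holomorphic_intros)
next
  fix z :: complex
  have "uniformly_convergent_on (cball z 1) (\<lambda>N x. \<Prod>j<N. 1 - x * p ^ j)"
  proof (rule uniformly_convergent_on_prod')
    show "uniformly_convergent_on (cball z 1) (\<lambda>N x. \<Sum>j<N. norm (1 - x * p ^ j - 1))"
    proof (rule Weierstrass_m_test'_ev)
      show "\<forall>\<^sub>F j in sequentially. \<forall>x\<in>cball z 1. norm (norm (1 - x * p ^ j - 1)) \<le> (norm z + 1) * norm p ^ j"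
      proof (intro always_eventually allI ballI)
        fix j x assume "x \<in> cball z 1"
        hence "norm x \<le> norm z + 1"
          by (metis dist_norm mem_cball norm_minus_commute norm_triangle_sub order_trans add_left_mono)
        thus "norm (norm (1 - x * p ^ j - 1)) \<le> (norm z + 1) * norm p ^ j"
          by (simp add: norm_mult norm_power mult_right_mono)
      qed
      show "summable (\<lambda>j. (norm z + 1) * norm p ^ j)"
        using assms by (intro summable_mult summable_geometric) auto
    qed
  qed (auto intro!: continuous_intros)
  then obtain l where l: "uniform_limit (cball z 1) (\<lambda>N x. \<Prod>j<N. 1 - x * p ^ j) l sequentially"
    by (auto simp: uniformly_convergent_on_def)
  have "l x = qpoch_inf x p" if "x \<in> cball z 1" for x
    using tendsto_uniform_limitI[OF l that] qpoch_inf_LIMSEQ[OF assms] LIMSEQ_unique by blast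
  hence "uniform_limit (cball z 1) (\<lambda>N x. \<Prod>j<N. 1 - x * p ^ j) (\<lambda>x. qpoch_inf x p) sequentially"
    using l by (metis (no_types, lifting) uniform_limit_cong')
  thus "\<exists>d>0. cball z d \<subseteq> UNIV \<and> uniform_limit (cball z d) (\<lambda>N x. \<Prod>j<N. 1 - x * p ^ j)
      (\<lambda>x. qpoch_inf x p) sequentially"
    by (intro exI[of _ 1]) auto
qed

lemma qpoch_inf_holomorphic [holomorphic_intros]:
  assumes "norm p < 1" "f holomorphic_on A"
  shows "(\<lambda>z. qpoch_inf (f z) p) holomorphic_on A"
  using holomorphic_on_compose_gen[OF assms(2) qpoch_inf_holomorphic_UNIV[OF assms(1)]]
  by (auto simp: o_def)

lemma qpoch_inf_continuous [continuous_intros]: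
  assumes "norm p < 1" "continuous_on A f"
  shows "continuous_on A (\<lambda>z. qpoch_inf (f z) p)"
  using continuous_on_compose2[OF holomorphic_on_imp_continuous_on[OF
        qpoch_inf_holomorphic_UNIV[OF assms(1)]] assms(2)] by auto

lemma qpoch_0 [simp]: "qpoch x p 0 = 1"
  by (simp add: qpoch_def)

lemma qpoch_add_1:
  assumes "n \<ge> 0"
  shows "qpoch x p (n + 1) = qpoch x p n * (1 - x * p powi n)"
  using assms by (simp add: qpoch_def nat_add_distrib power_int_def)

lemma qpoch_diff_1:
  assumes "n \<le> 0"
  shows "qpoch x p (n - 1) = qpoch x p n / (1 - x * p powi (n - 1))"
proof -
  obtain m where m: "n = - int m"
    using assms by (metis add.inverse_inverse neg_0_le_iff_le zero_le_imp_eq_int)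
  have n1: "n - 1 = - int (Suc m)" using m by simp
  have "qpoch x p (n - 1) = (\<Prod>j=1..Suc m. inverse (1 - x * p powi (- int j)))"
    unfolding n1 qpoch_def by (simp del: of_nat_Suc)
  also have "\<dots> = (\<Prod>j=1..m. inverse (1 - x * p powi (- int j))) / (1 - x * p powi (n - 1))"
    unfolding n1 by (simp add: divide_inverse del: of_nat_Suc)
  also have "(\<Prod>j=1..m. inverse (1 - x * p powi (- int j))) = qpoch x p n"
    unfolding m qpoch_def by auto
  finally show ?thesis .
qed

lemma qpoch_of_nat: "qpoch x p (int k) = (\<Prod>j<k. 1 - x * p ^ j)"
  by (simp add: qpoch_def)

lemma qpoch_Suc: "qpoch x p (int (Suc k)) = qpoch x p (int k) * (1 - x * p ^ k)"
  unfolding qpoch_of_nat by simp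

lemma qpoch_Suc_shift: "qpoch x p (int (Suc k)) = (1 - x) * qpoch (x * p) p (int k)"
  unfolding qpoch_of_nat by (subst prod.lessThan_Suc_shift) (simp add: mult.assoc)

lemma qpoch_nonzero:
  assumes "\<And>j. j \<in> {0..<n} \<Longrightarrow> 1 - y * p powi j \<noteq> 0" "n \<ge> 0"
  shows "qpoch y p n \<noteq> 0"
proof -
  have "1 - y * p ^ j \<noteq> 0" if "j < nat n" for j
    using assms(1)[of "int j"] that by simp
  thus ?thesis using assms(2) by (simp add: qpoch_def)
qed

lemma qpoch_inf_nonzero:
  assumes "norm p < 1" "\<And>j::int. j \<ge> 0 \<Longrightarrow> 1 - y * p powi j \<noteq> 0"
  shows "qpoch_inf y p \<noteq> 0"
  using assms(2)[of "int _"] qpoch_inf_eq_0_iff[OF assms(1)] by fastforce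

text \<open>
  For \<open>n < 0\<close> the left-hand side has the additional factors \<open>1 - y p\<^sup>-\<^sup>j\<close>, and \<open>qpoch y p n\<close> is the
  product of their inverses. If one of them is \<open>0\<close>, then both sides are, by the convention for
  division by \<open>0\<close>.
\<close>

lemma qpoch_inf_shift:
  assumes "p \<noteq> 0" "norm p < 1" "n \<ge> 0 \<Longrightarrow> qpoch y p n \<noteq> 0"
  shows "qpoch_inf (y * p powi n) p = qpoch_inf y p / qpoch y p n"
  using assms(3)
proof (induction n rule: int_induct[where k = 0])
  case base
  thus ?case by simp
next
  case (step1 i)
  have nz: "qpoch y p i \<noteq> 0" "1 - y * p powi i \<noteq> 0"
    using step1 by (auto simp: qpoch_add_1)
  have "qpoch_inf y p / qpoch y p i = (1 - y * p powi i) * qpoch_inf (y * p powi (i + 1)) p"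
    using step1 nz qpoch_inf_step[OF assms(2), of "y * p powi i"] assms(1)
    by (simp add: power_int_add mult_ac)
  moreover have "qpoch y p (i + 1) = qpoch y p i * (1 - y * p powi i)"
    using step1(1) by (rule qpoch_add_1)
  ultimately show ?case using nz by (auto simp add: divide_simps mult_ac)
next
  case (step2 i)
  have IH: "qpoch_inf (y * p powi i) p = qpoch_inf y p / qpoch y p i"
    using step2 by (cases "i = 0") auto
  have "qpoch_inf (y * p powi (i - 1)) p = (1 - y * p powi (i - 1)) * qpoch_inf (y * p powi i) p"
    using qpoch_inf_step[OF assms(2), of "y * p powi (i - 1)"] assms(1)
    by (simp add: power_int_diff mult.assoc)
  thus ?case using IH step2(1) by (simp add: qpoch_diff_1)
qed

definition binom2 :: "int \<Rightarrow> int" where "binom2 n = n * (n - 1) div 2"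

lemma two_binom2: "2 * binom2 n = n * (n - 1)"
  unfolding binom2_def by (rule dvd_mult_div_cancel) auto

lemma binom2_0 [simp]: "binom2 0 = 0" by (simp add: binom2_def)

lemma binom2_add_1: "binom2 (n + 1) = binom2 n + n"
  using two_binom2[of n] two_binom2[of "n + 1"] by (simp add: algebra_simps)

lemma binom2_diff_1: "binom2 (n - 1) = binom2 n - n + 1"
  using two_binom2[of n] two_binom2[of "n - 1"] by (simp add: algebra_simps)

text \<open>
  The factors that are gained or lost, \<open>1 - p\<^sup>-\<^sup>j / y\<close>, are those of \<open>qpoch y p n\<close> up to the monomial
  \<open>- p\<^sup>-\<^sup>j / y\<close>. This moves a factor from the numerator of a well-poised quotient into an infinite
  product.
\<close>

lemma qpoch_inf_reflect:
  assumes "p \<noteq> 0" "norm p < 1" "y \<noteq> 0"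
    and "\<And>j. j \<in> {1..-n} \<Longrightarrow> 1 - y * p powi (- j) \<noteq> 0"
  shows "qpoch_inf (p powi (1 - n) / y) p =
           qpoch_inf (p / y) p * qpoch y p n * (- 1 / y) powi n * p powi (- binom2 n)"
  using assms(4)
proof (induction n rule: int_induct[where k = 0])
  case base
  thus ?case by simp
next
  case (step1 i)
  have "qpoch_inf (p powi (- i) / y) p = (1 - p powi (- i) / y) * qpoch_inf (p powi (1 - i) / y) p"
    using qpoch_inf_step[OF assms(2), of "p powi (- i) / y"] assms(1)
    by (simp add: power_int_diff power_int_minus field_simps)
  also have "qpoch_inf (p powi (1 - i) / y) p =
           qpoch_inf (p / y) p * qpoch y p i * (- 1 / y) powi i * p powi (- binom2 i)"
    using step1 by auto
  also have "1 - p powi (- i) / y = (1 - y * p powi i) * (- 1 / y) * p powi (- i)"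
    using assms by (simp add: power_int_minus field_simps)
  also have "(1 - y * p powi i) * (- 1 / y) * p powi (- i) *
      (qpoch_inf (p / y) p * qpoch y p i * (- 1 / y) powi i * p powi (- binom2 i)) =
      qpoch_inf (p / y) p * (qpoch y p i * (1 - y * p powi i)) *
        ((- 1 / y) powi i * (- 1 / y)) * (p powi (- binom2 i) * p powi (- i))"
    by (simp only: mult_ac)
  also have "qpoch y p i * (1 - y * p powi i) = qpoch y p (i + 1)"
    using step1(1) by (rule qpoch_add_1[symmetric])
  also have "(- 1 / y) powi i * (- 1 / y) = (- 1 / y) powi (i + 1)"
    using assms(3) by (simp add: power_int_add)
  also have "p powi (- binom2 i) * p powi (- i) = p powi (- binom2 (i + 1))"
    using assms(1) by (subst power_int_add[symmetric]) (simp_all add: binom2_add_1)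
  finally show ?case by simp
next
  case (step2 i)
  have nz: "1 - y * p powi (i - 1) \<noteq> 0"
    using step2(1) step2(3)[of "1 - i"] by simp
  have "qpoch_inf (p powi (1 - i) / y) p = (1 - p powi (1 - i) / y) * qpoch_inf (p powi (2 - i) / y) p"
    using qpoch_inf_step[OF assms(2), of "p powi (1 - i) / y"] assms(1)
    by (simp add: power_int_diff power_int_minus field_simps power2_eq_square)
  moreover have "1 - p powi (1 - i) / y = (1 - y * p powi (i - 1)) * (- 1 / y) * p powi (1 - i)"
    using assms by (simp add: power_int_minus power_int_diff field_simps)
  moreover have "qpoch_inf (p powi (1 - i) / y) p =
           qpoch_inf (p / y) p * qpoch y p i * (- 1 / y) powi i * p powi (- binom2 i)"
    using step2 by auto
  ultimately have "(1 - y * p powi (i - 1)) * qpoch_inf (p powi (2 - i) / y) p * (- 1 / y) * p powi (1 - i) =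
      qpoch_inf (p / y) p * qpoch y p i * (- 1 / y) powi i * p powi (- binom2 i)"
    by (simp add: mult_ac)
  hence "qpoch_inf (p powi (2 - i) / y) p =
      qpoch_inf (p / y) p * (qpoch y p i / (1 - y * p powi (i - 1))) *
        ((- 1 / y) powi i / (- 1 / y)) * (p powi (- binom2 i) / p powi (1 - i))"
    using nz assms(1,3) by (simp add: field_simps)
  also have "(- 1 / y) powi i / (- 1 / y) = (- 1 / y) powi (i - 1)"
    using assms(3) by (simp add: power_int_diff)
  also have "p powi (- binom2 i) / p powi (1 - i) = p powi (- binom2 (i - 1))"
    using assms(1) by (subst power_int_diff[symmetric]) (auto simp: binom2_diff_1 algebra_simps)
  finally show ?case using step2(1) by (simp add: qpoch_diff_1)
qed

section \<open>Growth of q-shifted factorials along a geometric progression\<close>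

text \<open>
  The infinite product over \<open>1 + u r\<^sup>j\<close>, a real number for real arguments. Taking the norm of the
  complex product makes its recursion a case of the complex one.
\<close>

definition qpoch_majorant :: "real \<Rightarrow> real \<Rightarrow> real" where
  "qpoch_majorant u r = norm (qpoch_inf (- of_real u) (of_real r))"

lemma qpoch_majorant_LIMSEQ:
  assumes "0 \<le> u" "0 \<le> r" "r < 1"
  shows "(\<lambda>N. \<Prod>j<N. 1 + u * r ^ j) \<longlonglongrightarrow> qpoch_majorant u r"
proof -
  have "norm (1 - (- complex_of_real u) * of_real r ^ j) = 1 + u * r ^ j" for j
  proof -
    have "1 - (- complex_of_real u) * of_real r ^ j = of_real (1 + u * r ^ j)" by simp
    moreover have "1 + u * r ^ j \<ge> 0" using assms by simp
    ultimately show ?thesis by (metis norm_of_real abs_of_nonneg)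
  qed
  hence "(\<Prod>j<N. 1 + u * r ^ j) = norm (\<Prod>j<N. 1 - (- complex_of_real u) * of_real r ^ j)" for N
    by (simp add: prod_norm[symmetric])
  moreover have "(\<lambda>N. norm (\<Prod>j<N. 1 - (- complex_of_real u) * of_real r ^ j)) \<longlonglongrightarrow> qpoch_majorant u r"
    unfolding qpoch_majorant_def using assms by (intro tendsto_norm qpoch_inf_LIMSEQ) auto
  ultimately show ?thesis by simp
qed

lemma qpoch_majorant_nonneg: "qpoch_majorant u r \<ge> 0" by (simp add: qpoch_majorant_def)

lemma qpoch_majorant_step:
  assumes "0 \<le> u" "0 \<le> r" "r < 1"
  shows "qpoch_majorant u r = (1 + u) * qpoch_majorant (u * r) r"
proof -
  have "norm (1 - - complex_of_real u) = 1 + u"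
    using assms(1) by (metis abs_of_nonneg add_nonneg_nonneg diff_minus_eq_add norm_of_real
        of_real_1 of_real_add zero_le_one)
  thus ?thesis using assms unfolding qpoch_majorant_def
    by (subst qpoch_inf_step) (simp_all add: norm_mult)
qed

lemma qpoch_majorant_le_exp:
  assumes "0 \<le> u" "0 \<le> r" "r < 1"
  shows "qpoch_majorant u r \<le> exp (u / (1 - r))"
proof (rule LIMSEQ_le_const2[OF qpoch_majorant_LIMSEQ[OF assms]], intro exI allI impI)
  fix N :: nat
  have "(\<Prod>j<N. 1 + u * r ^ j) \<le> exp (\<Sum>j<N. u * r ^ j)"
    using assms by (intro prod_le_exp_sum) auto
  also have "(\<Sum>j<N. u * r ^ j) \<le> (\<Sum>j. u * r ^ j)"
    using assms by (intro sum_le_suminf summable_mult summable_geometric) auto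
  also have "\<dots> = u / (1 - r)"
    using assms by (subst suminf_mult) (auto simp: suminf_geometric summable_geometric)
  finally show "(\<Prod>j<N. 1 + u * r ^ j) \<le> exp (u / (1 - r))" by simp
qed

lemma norm_qpoch_inf_le_qpoch_majorant:
  assumes "norm p < 1"
  shows "norm (qpoch_inf y p) \<le> qpoch_majorant (norm y) (norm p)"
proof (rule LIMSEQ_le)
  show "(\<lambda>N. norm (\<Prod>j<N. 1 - y * p ^ j)) \<longlonglongrightarrow> norm (qpoch_inf y p)"
    by (intro tendsto_norm qpoch_inf_LIMSEQ assms)
  show "(\<lambda>N. \<Prod>j<N. 1 + norm y * norm p ^ j) \<longlonglongrightarrow> qpoch_majorant (norm y) (norm p)"
    using assms by (intro qpoch_majorant_LIMSEQ) auto
  have "norm (1 - y * p ^ j) \<le> 1 + norm y * norm p ^ j" for j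
    by (metis norm_mult norm_one norm_power norm_triangle_ineq4)
  thus "\<exists>N. \<forall>n\<ge>N. norm (\<Prod>j<n. 1 - y * p ^ j) \<le> (\<Prod>j<n. 1 + norm y * norm p ^ j)"
    by (auto simp: prod_norm[symmetric] intro!: prod_mono)
qed

text \<open>
  Each factor \<open>1 + u r\<^sup>2\<^sup>j\<close> is at most its left neighbour \<open>1 + u r\<^sup>2\<^sup>j\<^sup>-\<^sup>1\<close>, so that the square of the
  product over even powers is dominated by the product over all powers from the exponent \<open>-1\<close> on.
  In this way bounds in base \<open>q\<close> give bounds in base \<open>q\<^sup>2\<close> without distinguishing parities. The price
  is that the bilateral sum will be dominated by powers of \<open>|q|\<^sup>1\<^sup>/\<^sup>2\<close> instead of \<open>|q|\<close>.
\<close>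

lemma norm_qpoch_inf_square_le_qpoch_majorant:
  assumes "0 < norm q" "norm q < 1"
  shows "(norm (qpoch_inf y (q\<^sup>2)))\<^sup>2 \<le> qpoch_majorant (norm y / norm q) (norm q)"
proof (rule LIMSEQ_le)
  define r where "r = norm q"
  have r: "0 < r" "r < 1" using assms by (auto simp: r_def)
  have q2: "norm (q\<^sup>2) < 1" using assms by (simp add: norm_power power_less_one_iff)
  show "(\<lambda>N. (norm (\<Prod>j<N. 1 - y * (q\<^sup>2) ^ j))\<^sup>2) \<longlonglongrightarrow> (norm (qpoch_inf y (q\<^sup>2)))\<^sup>2"
    by (intro tendsto_intros qpoch_inf_LIMSEQ q2)
  show "(\<lambda>N. \<Prod>j<2 * N. 1 + norm y / r * r ^ j) \<longlonglongrightarrow> qpoch_majorant (norm y / norm q) (norm q)"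
    using LIMSEQ_subseq_LIMSEQ[OF qpoch_majorant_LIMSEQ[of "norm y / r" r], of "\<lambda>N. 2 * N"] r
    by (simp add: strict_mono_def o_def r_def)
  have "(norm (\<Prod>j<N. 1 - y * (q\<^sup>2) ^ j))\<^sup>2 \<le> (\<Prod>j<2 * N. 1 + norm y / r * r ^ j)" for N
  proof (induction N)
    case (Suc N)
    have 1: "norm (1 - y * (q\<^sup>2) ^ N) \<le> 1 + norm y * r ^ (2 * N)"
      by (metis norm_mult norm_one norm_power norm_triangle_ineq4 power_mult r_def)
    have 2: "norm y * r ^ (2 * N) \<le> norm y / r * r ^ (2 * N)"
      using r by (intro mult_right_mono) (auto simp: field_simps mult_left_le_one_le)
    have 3: "norm y * r ^ (2 * N) = norm y / r * r ^ (2 * N + 1)" using r by simp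
    have "norm (1 - y * (q\<^sup>2) ^ N) * norm (1 - y * (q\<^sup>2) ^ N) \<le>
        (1 + norm y / r * r ^ (2 * N)) * (1 + norm y / r * r ^ (2 * N + 1))"
    proof (rule mult_mono)
      show "norm (1 - y * (q\<^sup>2) ^ N) \<le> 1 + norm y / r * r ^ (2 * N)"
        using 1 2 by linarith
      show "norm (1 - y * (q\<^sup>2) ^ N) \<le> 1 + norm y / r * r ^ (2 * N + 1)"
        using 1 unfolding 3 .
    qed (use r in auto)
    hence "(norm (1 - y * (q\<^sup>2) ^ N))\<^sup>2 \<le>
        (1 + norm y / r * r ^ (2 * N)) * (1 + norm y / r * r ^ (2 * N + 1))"
      by (simp only: power2_eq_square)
    hence "(norm (\<Prod>j<N. 1 - y * (q\<^sup>2) ^ j))\<^sup>2 * (norm (1 - y * (q\<^sup>2) ^ N))\<^sup>2 \<le>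
        (\<Prod>j<2 * N. 1 + norm y / r * r ^ j) *
        ((1 + norm y / r * r ^ (2 * N)) * (1 + norm y / r * r ^ (2 * N + 1)))"
      using Suc.IH r by (intro mult_mono) (auto intro!: prod_nonneg)
    thus ?case by (simp add: norm_mult power_mult_distrib mult_ac)
  qed simp
  thus "\<exists>M. \<forall>N\<ge>M. (norm (\<Prod>j<N. 1 - y * (q\<^sup>2) ^ j))\<^sup>2 \<le> (\<Prod>j<2 * N. 1 + norm y / r * r ^ j)"
    by blast
qed

fun triangle :: "nat \<Rightarrow> nat" where
  "triangle 0 = 0"
| "triangle (Suc n) = triangle n + Suc n"

lemma two_triangle: "2 * triangle n = n * (n + 1)"
  by (induction n) auto

text \<open>
  Moving the argument by \<open>n\<close> steps adds the factors \<open>1 + v / r\<^sup>i = (v / r\<^sup>i) (1 + r\<^sup>i / v)\<close> for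
  \<open>1 \<le> i \<le> n\<close>. The monomials give the main term, and what remains is bounded independently of \<open>n\<close>.
\<close>

lemma qpoch_majorant_shift_le:
  assumes "0 < v" "0 < r" "r < 1"
  shows "qpoch_majorant (v / r ^ n) r * r ^ triangle n \<le> v ^ n * exp ((1 / v + v) / (1 - r))"
proof -
  have eq: "qpoch_majorant (v / r ^ n) r * r ^ triangle n = v ^ n * (\<Prod>i<n. 1 + r / v * r ^ i) * qpoch_majorant v r"
  proof (induction n)
    case (Suc n)
    have "qpoch_majorant (v / r ^ Suc n) r = (1 + v / r ^ Suc n) * qpoch_majorant (v / r ^ n) r"
      using assms by (subst qpoch_majorant_step) auto
    hence "qpoch_majorant (v / r ^ Suc n) r * r ^ triangle (Suc n) =
        ((1 + v / r ^ Suc n) * r ^ Suc n) * (qpoch_majorant (v / r ^ n) r * r ^ triangle n)"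
      by (simp only: triangle.simps power_add mult_ac)
    also have "(1 + v / r ^ Suc n) * r ^ Suc n = v * (1 + r / v * r ^ n)"
      using assms by (simp add: field_simps)
    finally have "qpoch_majorant (v / r ^ Suc n) r * r ^ triangle (Suc n) =
        v * (1 + r / v * r ^ n) * (qpoch_majorant (v / r ^ n) r * r ^ triangle n)" .
    thus ?case unfolding Suc.IH by (simp add: mult_ac)
  qed simp
  have "(\<Prod>i<n. 1 + r / v * r ^ i) \<le> exp (\<Sum>i<n. r / v * r ^ i)"
    using assms by (intro prod_le_exp_sum) auto
  also have "(\<Sum>i<n. r / v * r ^ i) \<le> (\<Sum>i. r / v * r ^ i)"
    using assms by (intro sum_le_suminf summable_mult summable_geometric) auto
  also have "\<dots> = r / v / (1 - r)"
    using assms by (subst suminf_mult) (auto simp: suminf_geometric summable_geometric)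
  also have "\<dots> \<le> 1 / v / (1 - r)"
    using assms by (intro divide_right_mono) auto
  finally have "(\<Prod>i<n. 1 + r / v * r ^ i) \<le> exp (1 / v / (1 - r))" by simp
  hence "v ^ n * (\<Prod>i<n. 1 + r / v * r ^ i) * qpoch_majorant v r \<le>
      v ^ n * exp (1 / v / (1 - r)) * exp (v / (1 - r))"
    using assms by (intro mult_mono mult_left_mono qpoch_majorant_le_exp qpoch_majorant_nonneg) (auto intro!: mult_nonneg_nonneg)
  thus ?thesis unfolding eq by (simp add: mult.assoc exp_add[symmetric] add_divide_distrib)
qed

text \<open>
  The product \<open>(wx, w/x; p)\<close>, the building block of functions of \<open>x\<close> that are invariant under
  \<open>x \<mapsto> 1/x\<close>.
\<close>

definition qpoch_sym :: "complex \<Rightarrow> complex \<Rightarrow> complex \<Rightarrow> complex" where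
  "qpoch_sym w x p = qpoch_inf (w * x) p * qpoch_inf (w / x) p"

lemma qpoch_sym_inverse: "qpoch_sym w (1 / x) p = qpoch_sym w x p"
  by (simp add: qpoch_sym_def)

lemma norm_qpoch_sym_le:
  assumes q: "0 < norm q" "norm q < 1" and nz: "\<alpha> \<noteq> 0" "w \<noteq> 0"
    and R: "norm (w * \<alpha>) \<le> R" "norm (w / \<alpha>) \<le> R" "norm (\<alpha> / w) \<le> R"
  shows "norm (qpoch_sym w (\<alpha> * q ^ n) q) * norm q ^ triangle n \<le>
           norm (w / \<alpha>) ^ n * exp (3 * R / (1 - norm q))"
proof -
  define r where "r = norm q"
  have r: "0 < r" "r < 1" using q by (auto simp: r_def)
  have "norm (qpoch_inf (w * (\<alpha> * q ^ n)) q) \<le> exp (norm (w * (\<alpha> * q ^ n)) / (1 - r))"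
    unfolding r_def using q
    by (intro order_trans[OF norm_qpoch_inf_le_qpoch_majorant] qpoch_majorant_le_exp) auto
  also have "norm (w * (\<alpha> * q ^ n)) \<le> R"
    using R(1) r by (simp add: norm_mult norm_power r_def[symmetric])
      (smt (verit, best) mult.assoc mult_left_le norm_ge_zero mult_nonneg_nonneg power_le_one)
  finally have 1: "norm (qpoch_inf (w * (\<alpha> * q ^ n)) q) \<le> exp (R / (1 - r))"
    using r by (simp add: divide_right_mono)
  have "norm (qpoch_inf (w / (\<alpha> * q ^ n)) q) \<le> qpoch_majorant (norm (w / \<alpha>) / r ^ n) r"
    using norm_qpoch_inf_le_qpoch_majorant[OF q(2), of "w / (\<alpha> * q ^ n)"]
    by (simp add: norm_divide norm_mult norm_power r_def)
  hence "norm (qpoch_inf (w / (\<alpha> * q ^ n)) q) * r ^ triangle n \<le> qpoch_majorant (norm (w / \<alpha>) / r ^ n) r * r ^ triangle n"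
    using r by (intro mult_right_mono) auto
  also have "\<dots> \<le> norm (w / \<alpha>) ^ n * exp ((1 / norm (w / \<alpha>) + norm (w / \<alpha>)) / (1 - r))"
    using nz r by (intro qpoch_majorant_shift_le) auto
  also have "1 / norm (w / \<alpha>) + norm (w / \<alpha>) \<le> 2 * R"
    using R by (simp add: norm_divide)
  finally have 2: "norm (qpoch_inf (w / (\<alpha> * q ^ n)) q) * r ^ triangle n \<le>
      norm (w / \<alpha>) ^ n * exp (2 * R / (1 - r))"
    using r by (simp add: divide_right_mono mult_left_mono)
  have "norm (qpoch_sym w (\<alpha> * q ^ n) q) * r ^ triangle n \<le>
      exp (R / (1 - r)) * (norm (w / \<alpha>) ^ n * exp (2 * R / (1 - r)))"
    using mult_mono[OF 1 2] r by (simp add: qpoch_sym_def norm_mult mult_ac)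
  also have "\<dots> = norm (w / \<alpha>) ^ n * (exp (R / (1 - r)) * exp (2 * R / (1 - r)))"
    by (simp only: mult_ac)
  also have "exp (R / (1 - r)) * exp (2 * R / (1 - r)) = exp (3 * R / (1 - r))"
    by (simp add: exp_add[symmetric] add_divide_distrib[symmetric])
  finally show ?thesis by (simp add: r_def)
qed

lemma norm_qpoch_sym_square_le:
  assumes q: "0 < norm q" "norm q < 1" and nz: "\<alpha> \<noteq> 0" "w \<noteq> 0"
    and R: "norm (w * \<alpha>) \<le> R" "norm (w / \<alpha>) \<le> R" "norm (\<alpha> / w) \<le> R"
  shows "(norm (qpoch_sym w (\<alpha> * q ^ n) (q\<^sup>2)))\<^sup>2 * norm q ^ triangle n \<le>
           (norm (w / \<alpha>) / norm q) ^ n * exp (3 * (R / norm q) / (1 - norm q))"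
proof -
  define r where "r = norm q"
  have r: "0 < r" "r < 1" using q by (auto simp: r_def)
  have R0: "R \<ge> 0" using R(1) norm_ge_zero order_trans by blast
  have "(norm (qpoch_inf (w * (\<alpha> * q ^ n)) (q\<^sup>2)))\<^sup>2 \<le> exp (norm (w * (\<alpha> * q ^ n)) / r / (1 - r))"
    unfolding r_def using q
    by (intro order_trans[OF norm_qpoch_inf_square_le_qpoch_majorant] qpoch_majorant_le_exp) auto
  also have "norm (w * (\<alpha> * q ^ n)) \<le> R"
    using R(1) r by (simp add: norm_mult norm_power r_def[symmetric])
      (smt (verit, best) mult.assoc mult_left_le norm_ge_zero mult_nonneg_nonneg power_le_one)
  finally have 1: "(norm (qpoch_inf (w * (\<alpha> * q ^ n)) (q\<^sup>2)))\<^sup>2 \<le> exp (R / r / (1 - r))"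
    using r by (simp add: divide_right_mono)
  have "(norm (qpoch_inf (w / (\<alpha> * q ^ n)) (q\<^sup>2)))\<^sup>2 \<le> qpoch_majorant (norm (w / \<alpha>) / r / r ^ n) r"
    using norm_qpoch_inf_square_le_qpoch_majorant[OF q, of "w / (\<alpha> * q ^ n)"]
    by (simp add: norm_divide norm_mult norm_power r_def mult_ac)
  hence "(norm (qpoch_inf (w / (\<alpha> * q ^ n)) (q\<^sup>2)))\<^sup>2 * r ^ triangle n \<le>
      qpoch_majorant (norm (w / \<alpha>) / r / r ^ n) r * r ^ triangle n"
    using r by (intro mult_right_mono) auto
  also have "\<dots> \<le> (norm (w / \<alpha>) / r) ^ n *
      exp ((1 / (norm (w / \<alpha>) / r) + norm (w / \<alpha>) / r) / (1 - r))"
    using nz r by (intro qpoch_majorant_shift_le) auto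
  also have "1 / (norm (w / \<alpha>) / r) + norm (w / \<alpha>) / r \<le> 2 * (R / r)"
  proof -
    have "1 / (norm (w / \<alpha>) / r) = norm (\<alpha> / w) * r" by (simp add: norm_divide)
    also have "\<dots> \<le> R * 1" using R R0 r by (intro mult_mono) auto
    also have "\<dots> \<le> R / r" using R0 r by (simp add: field_simps mult_left_le)
    finally have "1 / (norm (w / \<alpha>) / r) \<le> R / r" .
    moreover have "norm (w / \<alpha>) / r \<le> R / r" using R r by (intro divide_right_mono) auto
    ultimately show ?thesis by linarith
  qed
  finally have 2: "(norm (qpoch_inf (w / (\<alpha> * q ^ n)) (q\<^sup>2)))\<^sup>2 * r ^ triangle n \<le>
      (norm (w / \<alpha>) / r) ^ n * exp (2 * (R / r) / (1 - r))"
    using r by (simp add: divide_right_mono mult_left_mono)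
  have "(norm (qpoch_sym w (\<alpha> * q ^ n) (q\<^sup>2)))\<^sup>2 * r ^ triangle n \<le>
      exp (R / r / (1 - r)) * ((norm (w / \<alpha>) / r) ^ n * exp (2 * (R / r) / (1 - r)))"
    using mult_mono[OF 1 2] r by (simp add: qpoch_sym_def norm_mult power_mult_distrib mult_ac)
  also have "\<dots> = (norm (w / \<alpha>) / r) ^ n * (exp (R / r / (1 - r)) * exp (2 * (R / r) / (1 - r)))"
    by (simp only: mult_ac)
  also have "exp (R / r / (1 - r)) * exp (2 * (R / r) / (1 - r)) = exp (3 * (R / r) / (1 - r))"
    by (simp add: exp_add[symmetric] add_divide_distrib[symmetric])
  finally show ?thesis by (simp add: r_def)
qed

section \<open>The bilateral sum in symmetric form\<close>

text \<open>
  The summand at \<open>x = \<alpha> q\<^sup>n\<close> after removal of its denominators, up to a constant and a monomial in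
  \<open>\<alpha>\<close> and \<open>q\<close>. The factors
  \<open>(q / B) x\<^sup>\<plusminus>\<^sup>1\<close> and \<open>B q\<^sup>k\<^sup>+\<^sup>1 x\<^sup>\<plusminus>\<^sup>1\<close> come from the parameters \<open>b\<close> and \<open>a q\<^sup>-\<^sup>k / b\<close>, the factor
  \<open>(q\<^sup>1\<^sup>-\<^sup>k / C) x\<^sup>\<plusminus>\<^sup>1\<close> from \<open>c q\<^sup>k\<close>, and those in base \<open>q\<^sup>2\<close> are present in the original summand.
\<close>

definition kernel :: "complex \<Rightarrow> int \<Rightarrow> complex \<Rightarrow> complex \<Rightarrow> complex \<Rightarrow> complex" where
  "kernel q k B C x = (x - 1 / x) * qpoch_sym (B * q) x (q\<^sup>2) * qpoch_sym (C\<^sup>2 * q\<^sup>2 / B) x (q\<^sup>2) *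
     qpoch_sym (q powi (1 - k) / C) x q * qpoch_sym (B * q powi (k + 1)) x q * qpoch_sym (q / B) x q"

definition kernel_term :: "complex \<Rightarrow> int \<Rightarrow> complex \<Rightarrow> complex \<Rightarrow> complex \<Rightarrow> int \<Rightarrow> complex" where
  "kernel_term q k B C \<alpha> n = \<alpha> powi (4 * n) * q powi (2 * n\<^sup>2) * kernel q k B C (\<alpha> * q powi n)"

definition kernel_sum :: "complex \<Rightarrow> int \<Rightarrow> complex \<Rightarrow> complex \<Rightarrow> complex \<Rightarrow> complex" where
  "kernel_sum q k B C \<alpha> = (\<Sum>\<^sub>\<infinity>n. kernel_term q k B C \<alpha> n)"

lemma kernel_inverse: "kernel q k B C (1 / x) = - kernel q k B C x"
proof -
  have "1 / x - 1 / (1 / x) = - (x - 1 / x)" by simp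
  thus ?thesis unfolding kernel_def qpoch_sym_inverse by (simp only: mult_minus_left)
qed

lemma kernel_term_inverse: "kernel_term q k B C (1 / \<alpha>) (- n) = - kernel_term q k B C \<alpha> n"
proof -
  have "1 / \<alpha> * q powi (- n) = 1 / (\<alpha> * q powi n)"
    by (simp add: power_int_minus divide_inverse)
  moreover have "(1 / \<alpha>) powi (4 * - n) = \<alpha> powi (4 * n)"
    by (simp add: power_int_minus divide_inverse power_int_inverse)
  ultimately show ?thesis
    unfolding kernel_term_def by (simp only: kernel_inverse) simp
qed

text \<open>
  The infinite products grow like \<open>|q|\<close> to the power \<open>-n\<^sup>2/2\<close> for each of the three pairs in base \<open>q\<close>
  and \<open>-n\<^sup>2/4\<close> for each of the two in base \<open>q\<^sup>2\<close>, which cancels the factor \<open>q\<close> to the power \<open>2n\<^sup>2\<close> and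
  leaves a geometric rate. The constant depends only on a bound \<open>R\<close> for the parameters, so that the
  estimate is locally uniform.
\<close>

lemma norm_kernel_term_square_le:
  fixes q B C \<alpha> :: complex and k :: int and n :: nat
  defines "W \<equiv> {B * q, C\<^sup>2 * q\<^sup>2 / B, q powi (1 - k) / C, B * q powi (k + 1), q / B}"
  assumes q: "0 < norm q" "norm q < 1" and nz: "\<alpha> \<noteq> 0" "B \<noteq> 0" "C \<noteq> 0"
    and R: "norm \<alpha> \<le> R" "norm (1 / \<alpha>) \<le> R"
      "\<And>w. w \<in> W \<Longrightarrow> norm (w * \<alpha>) \<le> R" "\<And>w. w \<in> W \<Longrightarrow> norm (w / \<alpha>) \<le> R"
      "\<And>w. w \<in> W \<Longrightarrow> norm (\<alpha> / w) \<le> R"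
  shows "(norm (kernel_term q k B C \<alpha> (int n)))\<^sup>2 \<le>
     4 * R\<^sup>2 * ((exp (3 * (R / norm q) / (1 - norm q)))\<^sup>2 * (exp (3 * R / (1 - norm q))) ^ 6) * norm q ^ n"
proof -
  define r where "r = norm q"
  have r: "0 < r" "r < 1" using q by (auto simp: r_def)
  have q0: "q \<noteq> 0" using q by auto
  define A where "A = norm \<alpha>"
  have A: "A > 0" using nz by (simp add: A_def)
  define K1 where "K1 = exp (3 * R / (1 - r))"
  define K2 where "K2 = exp (3 * (R / r) / (1 - r))"
  define x where "x = \<alpha> * q ^ n"
  define w1 where "w1 = B * q"
  define w2 where "w2 = C\<^sup>2 * q\<^sup>2 / B"
  define w3 where "w3 = q powi (1 - k) / C"
  define w4 where "w4 = B * q powi (k + 1)"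
  define w5 where "w5 = q / B"
  have W: "W = {w1, w2, w3, w4, w5}"
    by (simp add: W_def w1_def w2_def w3_def w4_def w5_def)
  have wnz: "w1 \<noteq> 0" "w2 \<noteq> 0" "w3 \<noteq> 0" "w4 \<noteq> 0" "w5 \<noteq> 0"
    using nz q0 by (auto simp: w1_def w2_def w3_def w4_def w5_def)
  define P1 where "P1 = norm (qpoch_sym w1 x (q\<^sup>2))"
  define P2 where "P2 = norm (qpoch_sym w2 x (q\<^sup>2))"
  define P3 where "P3 = norm (qpoch_sym w3 x q)"
  define P4 where "P4 = norm (qpoch_sym w4 x q)"
  define P5 where "P5 = norm (qpoch_sym w5 x q)"
  define T where "T = triangle n"
  have b1: "P1\<^sup>2 * r ^ T \<le> (norm (w1 / \<alpha>) / r) ^ n * K2"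
    unfolding P1_def T_def r_def K2_def x_def
    using W wnz nz by (intro norm_qpoch_sym_square_le q R) auto
  have b2: "P2\<^sup>2 * r ^ T \<le> (norm (w2 / \<alpha>) / r) ^ n * K2"
    unfolding P2_def T_def r_def K2_def x_def
    using W wnz nz by (intro norm_qpoch_sym_square_le q R) auto
  have b3: "P3 * r ^ T \<le> norm (w3 / \<alpha>) ^ n * K1"
    unfolding P3_def T_def r_def K1_def x_def
    using W wnz nz by (intro norm_qpoch_sym_le q R) auto
  have b4: "P4 * r ^ T \<le> norm (w4 / \<alpha>) ^ n * K1"
    unfolding P4_def T_def r_def K1_def x_def
    using W wnz nz by (intro norm_qpoch_sym_le q R) auto
  have b5: "P5 * r ^ T \<le> norm (w5 / \<alpha>) ^ n * K1"
    unfolding P5_def T_def r_def K1_def x_def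
    using W wnz nz by (intro norm_qpoch_sym_le q R) auto
  have Ppos: "P1 \<ge> 0" "P2 \<ge> 0" "P3 \<ge> 0" "P4 \<ge> 0" "P5 \<ge> 0"
    by (auto simp: P1_def P2_def P3_def P4_def P5_def)
  have prod5: "a1 * a2 * a3\<^sup>2 * a4\<^sup>2 * a5\<^sup>2 \<le> b1 * b2 * b3\<^sup>2 * b4\<^sup>2 * b5\<^sup>2"
    if "0 \<le> a1" "0 \<le> a2" "0 \<le> a3" "0 \<le> a4" "0 \<le> a5"
      "a1 \<le> b1" "a2 \<le> b2" "a3 \<le> b3" "a4 \<le> b4" "a5 \<le> b5"
    for a1 a2 a3 a4 a5 b1 b2 b3 b4 b5 :: real
    using that by (intro mult_mono power_mono mult_nonneg_nonneg zero_le_power) linarith+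
  have "(P1\<^sup>2 * r ^ T) * (P2\<^sup>2 * r ^ T) * (P3 * r ^ T)\<^sup>2 * (P4 * r ^ T)\<^sup>2 * (P5 * r ^ T)\<^sup>2 \<le>
     ((norm (w1 / \<alpha>) / r) ^ n * K2) * ((norm (w2 / \<alpha>) / r) ^ n * K2) *
     (norm (w3 / \<alpha>) ^ n * K1)\<^sup>2 * (norm (w4 / \<alpha>) ^ n * K1)\<^sup>2 * (norm (w5 / \<alpha>) ^ n * K1)\<^sup>2"
    using r Ppos by (intro prod5 b1 b2 b3 b4 b5 mult_nonneg_nonneg zero_le_power) auto
  also have "\<dots> = ((norm (w1 / \<alpha>) / r) * (norm (w2 / \<alpha>) / r) * (norm (w3 / \<alpha>))\<^sup>2 *
      (norm (w4 / \<alpha>))\<^sup>2 * (norm (w5 / \<alpha>))\<^sup>2) ^ n * (K2\<^sup>2 * K1 ^ 6)"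
    by (simp only: power_mult_distrib power_mult[symmetric] mult.commute[of 2 n])
      (simp add: eval_nat_numeral mult_ac)
  \<comment> \<open>The exponential rate: the parameter \<open>k\<close> cancels because the product of all the parameters
    does not involve it.\<close>
  also have "(norm (w1 / \<alpha>) / r) * (norm (w2 / \<alpha>) / r) * (norm (w3 / \<alpha>))\<^sup>2 *
      (norm (w4 / \<alpha>))\<^sup>2 * (norm (w5 / \<alpha>))\<^sup>2 = r ^ 7 / A ^ 8"
  proof -
    have e1: "w3 * w4 * w5 = q ^ 3 / C"
      using nz q0 by (simp add: w3_def w4_def w5_def power_int_diff power_int_add field_simps eval_nat_numeral)
    have e2: "w1 * w2 = C\<^sup>2 * q ^ 3"
      using nz by (simp add: w1_def w2_def field_simps eval_nat_numeral)
    have "norm (w1 * w2) * (norm (w3 * w4 * w5))\<^sup>2 = r ^ 9"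
      unfolding e1 e2 using nz by (simp add: norm_mult norm_divide norm_power r_def[symmetric] field_simps)
    moreover have "(norm (w1 / \<alpha>) / r) * (norm (w2 / \<alpha>) / r) * (norm (w3 / \<alpha>))\<^sup>2 *
      (norm (w4 / \<alpha>))\<^sup>2 * (norm (w5 / \<alpha>))\<^sup>2 = norm (w1 * w2) * (norm (w3 * w4 * w5))\<^sup>2 / (r\<^sup>2 * A ^ 8)"
      by (simp add: norm_mult norm_divide A_def power_mult_distrib power_divide eval_nat_numeral mult_ac)
    ultimately show ?thesis using r A by (simp add: field_simps eval_nat_numeral)
  qed
  finally have L: "(P1\<^sup>2 * r ^ T) * (P2\<^sup>2 * r ^ T) * (P3 * r ^ T)\<^sup>2 * (P4 * r ^ T)\<^sup>2 * (P5 * r ^ T)\<^sup>2 \<le>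
      (r ^ 7 / A ^ 8) ^ n * (K2\<^sup>2 * K1 ^ 6)" .
  have xb: "(norm (x - 1 / x) * r ^ n)\<^sup>2 \<le> (2 * R)\<^sup>2"
  proof (rule power_mono)
    have rn: "r ^ n \<le> 1" using r by (simp add: power_le_one)
    have "norm (x - 1 / x) * r ^ n \<le> (norm x + norm (1 / x)) * r ^ n"
      using r by (intro mult_right_mono norm_triangle_ineq4) auto
    also have "\<dots> = A * (r ^ n * r ^ n) + norm (1 / \<alpha>)"
      using r nz by (simp add: x_def norm_mult norm_divide norm_power A_def r_def[symmetric] field_simps)
    also have "\<dots> \<le> A * (1 * 1) + norm (1 / \<alpha>)"
      using r rn A by (intro add_mono mult_mono mult_left_mono) auto
    also have "\<dots> \<le> 2 * R" using R(1,2) by (simp add: A_def)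
    finally show "norm (x - 1 / x) * r ^ n \<le> 2 * R" .
  qed (use r in auto)
  have "2 * int n ^ 2 = int (2 * n\<^sup>2)" by simp
  hence nt: "norm (kernel_term q k B C \<alpha> (int n)) =
      A ^ (4 * n) * r ^ (2 * n\<^sup>2) * (norm (x - 1 / x) * P1 * P2 * P3 * P4 * P5)"
    unfolding kernel_term_def kernel_def x_def[symmetric] w1_def[symmetric] w2_def[symmetric]
      w3_def[symmetric] w4_def[symmetric] w5_def[symmetric] power_int_of_nat
    by (simp add: norm_mult norm_power_int norm_power A_def r_def P1_def P2_def P3_def P4_def P5_def
        x_def w1_def w2_def w3_def w4_def w5_def power_int_def nat_mult_distrib nat_power_eq)
  have T8: "8 * T = 4 * n\<^sup>2 + 4 * n" using two_triangle[of n] by (simp add: T_def power2_eq_square algebra_simps)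
  have "(norm (kernel_term q k B C \<alpha> (int n)))\<^sup>2 * r ^ (6 * n) =
      A ^ (8 * n) * (norm (x - 1 / x) * r ^ n)\<^sup>2 *
      ((P1\<^sup>2 * r ^ T) * (P2\<^sup>2 * r ^ T) * (P3 * r ^ T)\<^sup>2 * (P4 * r ^ T)\<^sup>2 * (P5 * r ^ T)\<^sup>2)"
  proof -
    have e1: "(r ^ (2 * n\<^sup>2))\<^sup>2 * r ^ (6 * n) = (r ^ n)\<^sup>2 * r ^ (8 * T)"
      unfolding T8 by (simp add: power_mult[symmetric] power_add[symmetric] algebra_simps)
    have e2: "(A ^ (4 * n))\<^sup>2 = A ^ (8 * n)" by (simp add: power_mult[symmetric] mult_ac)
    have e3: "r ^ (8 * T) = r ^ T * r ^ T * (r ^ T)\<^sup>2 * (r ^ T)\<^sup>2 * (r ^ T)\<^sup>2"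
      by (simp add: power_mult[symmetric] power_add[symmetric])
    have "(norm (kernel_term q k B C \<alpha> (int n)))\<^sup>2 * r ^ (6 * n) =
       (A ^ (4 * n))\<^sup>2 * ((r ^ (2 * n\<^sup>2))\<^sup>2 * r ^ (6 * n)) *
       ((norm (x - 1 / x))\<^sup>2 * P1\<^sup>2 * P2\<^sup>2 * P3\<^sup>2 * P4\<^sup>2 * P5\<^sup>2)"
      unfolding nt by (simp only: power_mult_distrib mult_ac)
    thus ?thesis unfolding e1 e2 e3 by (simp only: power_mult_distrib mult_ac)
  qed
  also have "\<dots> \<le> A ^ (8 * n) * (2 * R)\<^sup>2 * ((r ^ 7 / A ^ 8) ^ n * (K2\<^sup>2 * K1 ^ 6))"
    by (rule mult_mono[OF mult_left_mono[OF xb] L])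
      (use r A Ppos in \<open>auto intro!: mult_nonneg_nonneg zero_le_power\<close>)
  also have "\<dots> = 4 * R\<^sup>2 * (K2\<^sup>2 * K1 ^ 6) * r ^ n * r ^ (6 * n)"
    using A by (simp add: power_divide power_mult[symmetric] power_add[symmetric] power_mult_distrib)
  finally show ?thesis using r unfolding K1_def K2_def r_def by (simp add: mult_le_cancel_right)
qed

lemma summable_on_geometric_int:
  fixes s :: real
  assumes "0 \<le> s" "s < 1"
  shows "(\<lambda>n::int. s ^ nat \<bar>n\<bar>) summable_on UNIV"
proof -
  have g: "(\<lambda>n::nat. s ^ n) summable_on UNIV"
    using assms by (intro norm_summable_imp_summable_on) (simp add: summable_geometric)
  have "(\<lambda>n::int. s ^ nat \<bar>n\<bar>) summable_on (range int)"
    using g by (subst summable_on_reindex) (auto simp: o_def)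
  moreover have "(\<lambda>n::int. s ^ nat \<bar>n\<bar>) summable_on (range (\<lambda>n. - int n))"
    using g by (subst summable_on_reindex) (auto simp: o_def inj_on_def)
  ultimately have "(\<lambda>n::int. s ^ nat \<bar>n\<bar>) summable_on (range int \<union> range (\<lambda>n. - int n))"
    by (rule summable_on_union)
  also have "range int \<union> range (\<lambda>n. - int n) = UNIV"
    by (auto simp: image_iff) (metis int_cases2)
  finally show ?thesis .
qed

text \<open>
  Negative indices reduce to positive ones by the symmetry \<open>\<alpha> \<mapsto> 1/\<alpha>\<close>. Letting both \<open>\<alpha>\<close> and \<open>B\<close> vary
  covers the two uses: holomorphy in \<open>\<alpha>\<close> for fixed \<open>B\<close>, and continuity in \<open>B\<close> for fixed \<open>\<alpha>\<close>.
\<close>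

lemma kernel_term_bound:
  fixes \<alpha> B :: "complex \<Rightarrow> complex"
  assumes q: "0 < norm q" "norm q < 1" and C: "C \<noteq> 0"
    and S: "compact S" "continuous_on S \<alpha>" "continuous_on S B"
      "\<And>s. s \<in> S \<Longrightarrow> \<alpha> s \<noteq> 0" "\<And>s. s \<in> S \<Longrightarrow> B s \<noteq> 0"
  shows "\<exists>K. \<forall>s\<in>S. \<forall>n. norm (kernel_term q k (B s) C (\<alpha> s) n) \<le> K * sqrt (norm q) ^ nat \<bar>n\<bar>"
proof -
  have q0: "q \<noteq> 0" using q by auto
  define g :: "complex \<Rightarrow> complex \<Rightarrow> real" where
    "g = (\<lambda>w a. norm (w * a) + norm (w / a) + norm (a / w) + norm (1 / (a * w)))"
  define h where "h = (\<lambda>s. norm (\<alpha> s) + norm (1 / \<alpha> s) + g (B s * q) (\<alpha> s) +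
     g (C\<^sup>2 * q\<^sup>2 / B s) (\<alpha> s) + g (q powi (1 - k) / C) (\<alpha> s) +
     g (B s * q powi (k + 1)) (\<alpha> s) + g (q / B s) (\<alpha> s))"
  have "continuous_on S h"
    unfolding h_def g_def using S q0 C by (intro continuous_intros) auto
  hence "bounded (h ` S)"
    using S(1) compact_continuous_image compact_imp_bounded by blast
  then obtain R where R: "\<And>s. s \<in> S \<Longrightarrow> h s \<le> R"
    unfolding bounded_real by (metis abs_le_D1 imageI)
  define K0 where "K0 = 4 * R\<^sup>2 * ((exp (3 * (R / norm q) / (1 - norm q)))\<^sup>2 * (exp (3 * R / (1 - norm q))) ^ 6)"
  have K0: "K0 \<ge> 0" unfolding K0_def by simp
  have "norm (kernel_term q k (B s) C (\<alpha> s) n) \<le> sqrt K0 * sqrt (norm q) ^ nat \<bar>n\<bar>" if s: "s \<in> S" for s n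
  proof -
    let ?W = "{B s * q, C\<^sup>2 * q\<^sup>2 / B s, q powi (1 - k) / C, B s * q powi (k + 1), q / B s}"
    have g0: "g w a \<ge> 0" for w a by (simp add: g_def)
    have gR: "g w (\<alpha> s) \<le> R" if "w \<in> ?W" for w
      using that R[OF s] g0 norm_ge_zero[of "\<alpha> s"] norm_ge_zero[of "1 / \<alpha> s"] unfolding h_def
      by (smt (verit, ccfv_threshold) empty_iff insert_iff)
    have R1: "norm (w * \<alpha> s) \<le> R" "norm (w / \<alpha> s) \<le> R" "norm (\<alpha> s / w) \<le> R" "norm (1 / (\<alpha> s * w)) \<le> R"
      if "w \<in> ?W" for w
      using gR[OF that] norm_ge_zero[of "w * \<alpha> s"] norm_ge_zero[of "w / \<alpha> s"]
        norm_ge_zero[of "\<alpha> s / w"] norm_ge_zero[of "1 / (\<alpha> s * w)"]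
      unfolding g_def by linarith+
    have R2: "norm (\<alpha> s) \<le> R" "norm (1 / \<alpha> s) \<le> R"
      using R[OF s] g0[of "B s * q" "\<alpha> s"] g0[of "C\<^sup>2 * q\<^sup>2 / B s" "\<alpha> s"] g0[of "q powi (1 - k) / C" "\<alpha> s"]
        g0[of "B s * q powi (k + 1)" "\<alpha> s"] g0[of "q / B s" "\<alpha> s"]
        norm_ge_zero[of "\<alpha> s"] norm_ge_zero[of "1 / \<alpha> s"]
      unfolding h_def by linarith+
    have sq: "norm (kernel_term q k (B s) C (\<alpha> s) n) \<le> sqrt K0 * sqrt (norm q) ^ nat \<bar>n\<bar>"
      if "(norm (kernel_term q k (B s) C (\<alpha> s) n))\<^sup>2 \<le> K0 * norm q ^ nat \<bar>n\<bar>"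
      using real_sqrt_le_mono[OF that] by (simp add: real_sqrt_mult real_sqrt_power)
    show ?thesis
    proof (cases "n \<ge> 0")
      case True
      then obtain m where m: "n = int m" using zero_le_imp_eq_int by blast
      have "(norm (kernel_term q k (B s) C (\<alpha> s) (int m)))\<^sup>2 \<le> K0 * norm q ^ m"
        unfolding K0_def using s S C R1 R2 by (intro norm_kernel_term_square_le q) auto
      thus ?thesis using sq by (simp add: m)
    next
      case False
      then obtain m where m: "n = - int m"
        by (metis add.inverse_inverse linorder_not_le neg_0_less_iff_less zero_less_imp_eq_int)
      have "norm (kernel_term q k (B s) C (1 / \<alpha> s) (int m)) = norm (kernel_term q k (B s) C (\<alpha> s) (- int m))"
        using kernel_term_inverse[of q k "B s" C "\<alpha> s" "- int m"] by simp
      moreover have "(norm (kernel_term q k (B s) C (1 / \<alpha> s) (int m)))\<^sup>2 \<le> K0 * norm q ^ m"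
        unfolding K0_def
      proof (intro norm_kernel_term_square_le q)
        fix w assume w: "w \<in> ?W"
        show "norm (w * (1 / \<alpha> s)) \<le> R" "norm (w / (1 / \<alpha> s)) \<le> R" "norm (1 / \<alpha> s / w) \<le> R"
          using R1[OF w] by auto
      qed (use s S C R2 in auto)
      ultimately show ?thesis using sq by (simp add: m)
    qed
  qed
  thus ?thesis by blast
qed

lemma kernel_term_has_sum:
  assumes q: "0 < norm q" "norm q < 1" and nz: "B \<noteq> 0" "C \<noteq> 0" "\<alpha> \<noteq> 0"
  shows "(kernel_term q k B C \<alpha> has_sum kernel_sum q k B C \<alpha>) UNIV"
proof -
  obtain K where K: "\<And>n. norm (kernel_term q k B C \<alpha> n) \<le> K * sqrt (norm q) ^ nat \<bar>n\<bar>"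
    using kernel_term_bound[OF q nz(2), of "{0}" "\<lambda>_. \<alpha>" "\<lambda>_. B"] nz by auto
  have "(\<lambda>n::int. K * sqrt (norm q) ^ nat \<bar>n\<bar>) summable_on UNIV"
    using q by (intro summable_on_cmult_right summable_on_geometric_int) auto
  hence "(\<lambda>n. norm (kernel_term q k B C \<alpha> n)) summable_on UNIV"
    by (rule summable_on_comparison_test) (use K in auto)
  hence "kernel_term q k B C \<alpha> summable_on UNIV"
    by (rule abs_summable_summable)
  thus ?thesis unfolding kernel_sum_def by (rule has_sum_infsum)
qed

lemma kernel_sum_uniform_limit:
  fixes \<alpha> B :: "complex \<Rightarrow> complex"
  assumes q: "0 < norm q" "norm q < 1" and C: "C \<noteq> 0"
    and S: "compact S" "continuous_on S \<alpha>" "continuous_on S B"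
      "\<And>s. s \<in> S \<Longrightarrow> \<alpha> s \<noteq> 0" "\<And>s. s \<in> S \<Longrightarrow> B s \<noteq> 0"
  shows "uniform_limit S (\<lambda>X s. \<Sum>n\<in>X. kernel_term q k (B s) C (\<alpha> s) n)
           (\<lambda>s. kernel_sum q k (B s) C (\<alpha> s)) (finite_subsets_at_top UNIV)"
proof -
  obtain K where K: "\<And>s n. s \<in> S \<Longrightarrow> norm (kernel_term q k (B s) C (\<alpha> s) n) \<le> K * sqrt (norm q) ^ nat \<bar>n\<bar>"
    using kernel_term_bound[OF assms] by blast
  have "(\<lambda>n::int. K * sqrt (norm q) ^ nat \<bar>n\<bar>) summable_on UNIV"
    using q by (intro summable_on_cmult_right summable_on_geometric_int) auto
  thus ?thesis unfolding kernel_sum_def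
    by (intro Weierstrass_m_test_general[where M = "\<lambda>n. K * sqrt (norm q) ^ nat \<bar>n\<bar>"]) (auto intro: K)
qed

lemma qpoch_sym_holomorphic [holomorphic_intros]:
  assumes "norm p < 1" "f holomorphic_on A" "g holomorphic_on A" "\<And>z. z \<in> A \<Longrightarrow> g z \<noteq> 0"
  shows "(\<lambda>z. qpoch_sym (f z) (g z) p) holomorphic_on A"
  unfolding qpoch_sym_def using assms by (intro holomorphic_intros) auto

lemma kernel_term_holomorphic:
  assumes q: "0 < norm q" "norm q < 1"
    and h: "\<alpha> holomorphic_on A" "B holomorphic_on A"
      "\<And>s. s \<in> A \<Longrightarrow> \<alpha> s \<noteq> 0" "\<And>s. s \<in> A \<Longrightarrow> B s \<noteq> 0"
  shows "(\<lambda>s. kernel_term q k (B s) C (\<alpha> s) n) holomorphic_on A"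
proof -
  have q0: "q \<noteq> 0" and q2: "norm (q\<^sup>2) < 1"
    using q by (auto simp: norm_power power_less_one_iff)
  show ?thesis
    unfolding kernel_term_def kernel_def using assms q0 q2
    by (intro holomorphic_intros) auto
qed

lemma kernel_sum_holomorphic:
  fixes \<alpha> B :: "complex \<Rightarrow> complex"
  assumes q: "0 < norm q" "norm q < 1" and C: "C \<noteq> 0" and A: "open A"
    and h: "\<alpha> holomorphic_on A" "B holomorphic_on A"
      "\<And>s. s \<in> A \<Longrightarrow> \<alpha> s \<noteq> 0" "\<And>s. s \<in> A \<Longrightarrow> B s \<noteq> 0"
  shows "(\<lambda>s. kernel_sum q k (B s) C (\<alpha> s)) holomorphic_on A"
proof -
  have "\<exists>e>0. (\<lambda>s. kernel_sum q k (B s) C (\<alpha> s)) holomorphic_on ball z e" if z: "z \<in> A" for z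
  proof -
    obtain e where e: "e > 0" "cball z e \<subseteq> A"
      using A z open_contains_cball by blast
    have sub: "f holomorphic_on A \<Longrightarrow> continuous_on (cball z e) f" for f
      using e by (meson holomorphic_on_imp_continuous_on holomorphic_on_subset)
    have ul: "uniform_limit (cball z e) (\<lambda>X s. \<Sum>n\<in>X. kernel_term q k (B s) C (\<alpha> s) n)
           (\<lambda>s. kernel_sum q k (B s) C (\<alpha> s)) (finite_subsets_at_top UNIV)"
      using e h by (intro kernel_sum_uniform_limit q C sub compact_cball) auto
    have hol: "(\<lambda>s. \<Sum>n\<in>X. kernel_term q k (B s) C (\<alpha> s) n) holomorphic_on A" for X
      using h by (intro holomorphic_intros kernel_term_holomorphic q) auto
    have "\<forall>\<^sub>F X in finite_subsets_at_top UNIV.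
        continuous_on (cball z e) (\<lambda>s. \<Sum>n\<in>X. kernel_term q k (B s) C (\<alpha> s) n) \<and>
        (\<lambda>s. \<Sum>n\<in>X. kernel_term q k (B s) C (\<alpha> s) n) holomorphic_on ball z e"
    proof (intro always_eventually allI conjI)
      fix X :: "int set"
      show "continuous_on (cball z e) (\<lambda>s. \<Sum>n\<in>X. kernel_term q k (B s) C (\<alpha> s) n)"
        by (rule sub[OF hol])
      show "(\<lambda>s. \<Sum>n\<in>X. kernel_term q k (B s) C (\<alpha> s) n) holomorphic_on ball z e"
        by (rule holomorphic_on_subset[OF hol]) (use e in force)
    qed
    from holomorphic_uniform_limit[OF this ul finite_subsets_at_top_neq_bot]
    have "(\<lambda>s. kernel_sum q k (B s) C (\<alpha> s)) holomorphic_on ball z e" by blast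
    thus ?thesis using e(1) by blast
  qed
  hence "(\<lambda>s. kernel_sum q k (B s) C (\<alpha> s)) analytic_on A"
    unfolding analytic_on_def by blast
  thus ?thesis by (rule analytic_imp_holomorphic)
qed

section \<open>Theta functions and odd quasi-periodic functions\<close>

text \<open>
  At a zero of \<open>g\<close> the quotient extends by the quotient of the derivatives. The last conclusion, that
  zeros of \<open>g\<close> are isolated, lets bounds for the quotient be checked away from them.
\<close>

lemma holomorphic_quotient_simple_zeros:
  fixes f g :: "complex \<Rightarrow> complex"
  assumes f: "f holomorphic_on UNIV" and g: "g holomorphic_on UNIV"
    and zero: "\<And>z. g z = 0 \<Longrightarrow> f z = 0" and simple: "\<And>z. g z = 0 \<Longrightarrow> deriv g z \<noteq> 0"
  obtains G where "G holomorphic_on UNIV" "\<And>z. f z = G z * g z"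
    "\<And>z. eventually (\<lambda>w. g w \<noteq> 0) (at z)"
proof -
  define G where "G = (\<lambda>z. if g z = 0 then deriv f z / deriv g z else f z / g z)"
  have df: "(f has_field_derivative deriv f z) (at z)" for z
    using f holomorphic_derivI by blast
  have dg: "(g has_field_derivative deriv g z) (at z)" for z
    using g holomorphic_derivI by blast
  have contg: "isCont g z" for z using dg DERIV_isCont by blast
  have lim: "((\<lambda>w. f w / (w - z)) \<longlongrightarrow> deriv f z) (at z)"
    "((\<lambda>w. g w / (w - z)) \<longlongrightarrow> deriv g z) (at z)" if "g z = 0" for z
    using df[of z] dg[of z] that zero[OF that] by (auto simp: has_field_derivative_iff)
  have ev: "eventually (\<lambda>w. g w \<noteq> 0) (at z)" for z
  proof (cases "g z = 0")
    case True
    have "eventually (\<lambda>w. g w / (w - z) \<noteq> 0) (at z)"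
      using tendsto_imp_eventually_ne[OF lim(2)[OF True] simple[OF True]] .
    thus ?thesis by eventually_elim auto
  next
    case False
    thus ?thesis using contg tendsto_imp_eventually_ne unfolding isCont_def by blast
  qed
  have "G field_differentiable at z" for z
  proof -
    obtain e where e: "e > 0" "\<And>w. w \<noteq> z \<Longrightarrow> dist w z < e \<Longrightarrow> g w \<noteq> 0"
      using ev[of z] unfolding eventually_at by auto
    have "G holomorphic_on ball z e"
    proof (rule no_isolated_singularity'[where K = "{z}"])
      have "(\<lambda>w. f w / g w) holomorphic_on ball z e - {z}"
        using e by (intro holomorphic_intros holomorphic_on_subset[OF f] holomorphic_on_subset[OF g])
          (auto simp: dist_commute)
      thus "G holomorphic_on ball z e - {z}"
        by (rule holomorphic_transform) (use e in \<open>auto simp: G_def dist_commute\<close>)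
      have "(G \<longlongrightarrow> G z) (at z)"
      proof (cases "g z = 0")
        case True
        have "((\<lambda>w. (f w / (w - z)) / (g w / (w - z))) \<longlongrightarrow> G z) (at z)"
          using tendsto_divide[OF lim[OF True] simple[OF True]] True by (simp add: G_def)
        moreover have "eventually (\<lambda>w. (f w / (w - z)) / (g w / (w - z)) = G w) (at z)"
          using ev[of z] eventually_neq_at_within[of z z UNIV]
          by eventually_elim (auto simp: G_def)
        ultimately show ?thesis by (rule Lim_transform_eventually)
      next
        case False
        have "((\<lambda>w. f w / g w) \<longlongrightarrow> G z) (at z)"
          using False contg[of z] DERIV_isCont[OF df[of z]] unfolding G_def isCont_def
          by (auto intro!: tendsto_divide)
        moreover have "eventually (\<lambda>w. f w / g w = G w) (at z)"
          using ev[of z] by eventually_elim (auto simp: G_def)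
        ultimately show ?thesis by (rule Lim_transform_eventually)
      qed
      thus "\<And>w. w \<in> {z} \<Longrightarrow> (G \<longlongrightarrow> G w) (at w within ball z e)"
        using tendsto_within_subset by blast
    qed auto
    thus ?thesis using e(1) by (simp add: holomorphic_on_imp_differentiable_at)
  qed
  hence "G holomorphic_on UNIV" by (simp add: holomorphic_on_def field_differentiable_at_within)
  moreover have "f z = G z * g z" for z using zero by (auto simp: G_def)
  ultimately show ?thesis using that ev by blast
qed

text \<open>
  The modified Jacobi theta function.
\<close>

definition theta0 :: "complex \<Rightarrow> complex \<Rightarrow> complex" where
  "theta0 q y = qpoch_inf y q * qpoch_inf (q / y) q"

text \<open>
  The division by \<open>\<alpha>\<close> makes this function odd under \<open>\<alpha> \<mapsto> 1/\<alpha>\<close>, and the sign gives it the factor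
  \<open>\<alpha> - 1/\<alpha>\<close> in \<open>odd_theta_eq\<close>, which the kernel has as well.
\<close>

definition odd_theta :: "complex \<Rightarrow> complex \<Rightarrow> complex" where
  "odd_theta q \<alpha> = - theta0 q (\<alpha>\<^sup>2) / \<alpha>"

lemma odd_theta_eq:
  assumes "norm q < 1" "\<alpha> \<noteq> 0"
  shows "odd_theta q \<alpha> = (\<alpha> - 1 / \<alpha>) * (qpoch_inf (\<alpha>\<^sup>2 * q) q * qpoch_inf (q / \<alpha>\<^sup>2) q)"
proof -
  have "theta0 q (\<alpha>\<^sup>2) = (1 - \<alpha>\<^sup>2) * (qpoch_inf (\<alpha>\<^sup>2 * q) q * qpoch_inf (q / \<alpha>\<^sup>2) q)"
    unfolding theta0_def by (subst qpoch_inf_step[OF assms(1)]) simp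
  thus ?thesis using assms(2) unfolding odd_theta_def by (simp add: field_simps power2_eq_square)
qed

lemma theta0_mult:
  assumes "norm q < 1" "q \<noteq> 0" "y \<noteq> 0"
  shows "theta0 q (y * q) = - theta0 q y / y"
proof -
  have 1: "qpoch_inf y q = (1 - y) * qpoch_inf (y * q) q" by (rule qpoch_inf_step[OF assms(1)])
  have 2: "qpoch_inf (1 / y) q = (1 - 1 / y) * qpoch_inf (q / y) q"
    using qpoch_inf_step[OF assms(1), of "1 / y"] by simp
  have 3: "q / (y * q) = 1 / y" using assms by simp
  have "theta0 q (y * q) = (1 - 1 / y) * (qpoch_inf (y * q) q * qpoch_inf (q / y) q)"
    unfolding theta0_def 3 2 by (simp only: mult_ac)
  also have "1 - 1 / y = - (1 - y) / y" using assms(3) by (simp add: field_simps)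
  finally show ?thesis unfolding theta0_def 1 using assms(3) by (simp add: field_simps)
qed

lemma theta0_shift:
  assumes "norm q < 1" "q \<noteq> 0" "y \<noteq> 0"
  shows "theta0 q (y * q powi m) = (- 1 / y) powi m * q powi (- binom2 m) * theta0 q y"
proof (induction m rule: int_induct[where k = 0])
  case base
  thus ?case by simp
next
  case (step1 i)
  have "theta0 q (y * q powi (i + 1)) = - theta0 q (y * q powi i) / (y * q powi i)"
    using theta0_mult[OF assms(1,2), of "y * q powi i"] assms by (simp add: power_int_add mult.assoc)
  also have "\<dots> = ((- 1 / y) powi i * (- 1 / y)) * (q powi (- binom2 i) / q powi i) * theta0 q y"
    unfolding step1(2) using assms by (simp add: field_simps)
  also have "(- 1 / y) powi i * (- 1 / y) = (- 1 / y) powi (i + 1)"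
    using assms(3) by (simp add: power_int_add)
  also have "q powi (- binom2 i) / q powi i = q powi (- binom2 (i + 1))"
    using assms(2) by (subst power_int_diff[symmetric]) (simp_all add: binom2_add_1)
  finally show ?case .
next
  case (step2 i)
  have "theta0 q (y * q powi i) = - theta0 q (y * q powi (i - 1)) / (y * q powi (i - 1))"
    using theta0_mult[OF assms(1,2), of "y * q powi (i - 1)"] assms by (simp add: power_int_diff)
  hence "theta0 q (y * q powi (i - 1)) = - theta0 q (y * q powi i) * (y * q powi (i - 1))"
    using assms by (simp add: field_simps)
  also have "\<dots> = ((- 1 / y) powi i / (- 1 / y)) * (q powi (- binom2 i) * q powi (i - 1)) * theta0 q y"
    unfolding step2(2) using assms by (simp add: field_simps)
  also have "(- 1 / y) powi i / (- 1 / y) = (- 1 / y) powi (i - 1)"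
    using assms(3) by (simp add: power_int_diff)
  also have "q powi (- binom2 i) * q powi (i - 1) = q powi (- binom2 (i - 1))"
    using power_int_add[of q "- binom2 i" "i - 1"] assms(2) by (simp add: binom2_diff_1 algebra_simps)
  finally show ?case .
qed

lemma theta0_eq_0_iff:
  assumes "norm q < 1" "q \<noteq> 0" "y \<noteq> 0"
  shows "theta0 q y = 0 \<longleftrightarrow> (\<exists>m. y = q powi m)"
proof
  assume "theta0 q y = 0"
  then consider j where "y * q ^ j = 1" | j where "q / y * q ^ j = 1"
    using qpoch_inf_eq_0_iff[OF assms(1)] unfolding theta0_def by auto
  thus "\<exists>m. y = q powi m"
  proof cases
    case (1 j)
    hence "y = q powi (- int j)" using assms by (simp add: power_int_minus field_simps)
    thus ?thesis by blast
  next
    case (2 j)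
    hence "y = q powi int (Suc j)" using assms by (simp only: power_int_of_nat) (simp add: field_simps)
    thus ?thesis by blast
  qed
next
  assume "\<exists>m. y = q powi m"
  then obtain m where m: "y = 1 * q powi m" by auto
  have "qpoch_inf 1 q = 0" using qpoch_inf_step[OF assms(1), of 1] by simp
  thus "theta0 q y = 0"
    unfolding m using theta0_shift[OF assms(1,2), of 1 m] by (simp add: theta0_def)
qed

lemma odd_theta_mult:
  assumes "norm q < 1" "q \<noteq> 0" "\<alpha> \<noteq> 0"
  shows "odd_theta q (\<alpha> * q) = odd_theta q \<alpha> / (q\<^sup>2 * \<alpha> ^ 4)"
proof -
  have "(\<alpha> * q)\<^sup>2 = \<alpha>\<^sup>2 * q * q" by (simp add: power2_eq_square mult_ac)
  hence "theta0 q ((\<alpha> * q)\<^sup>2) = theta0 q (\<alpha>\<^sup>2) / (\<alpha> ^ 4 * q)"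
    using theta0_mult[OF assms(1,2), of "\<alpha>\<^sup>2 * q"] theta0_mult[OF assms(1,2), of "\<alpha>\<^sup>2"] assms
    by (simp add: field_simps eval_nat_numeral)
  thus ?thesis using assms by (simp add: odd_theta_def field_simps eval_nat_numeral)
qed

text \<open>
  By quasi-periodicity every zero of the theta function is a translate of the one at \<open>1\<close>, and there
  only the factor \<open>1 - y\<close> vanishes.
\<close>

lemma odd_theta_simple_zeros:
  assumes q: "norm q < 1" "q \<noteq> 0" and \<alpha>: "\<alpha> \<noteq> 0" "odd_theta q \<alpha> = 0"
  obtains m D where "\<alpha>\<^sup>2 = q powi m" "(odd_theta q has_field_derivative D) (at \<alpha>)" "D \<noteq> 0"
proof -
  obtain m where m: "\<alpha>\<^sup>2 = q powi m"
    using \<alpha> theta0_eq_0_iff[OF q, of "\<alpha>\<^sup>2"] by (auto simp: odd_theta_def)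
  define u where "u = (\<lambda>a. - ((- 1 / (a\<^sup>2 * q powi (- m))) powi m * q powi (- binom2 m) *
      (qpoch_inf (a\<^sup>2 * q powi (- m) * q) q * qpoch_inf (q / (a\<^sup>2 * q powi (- m))) q)) / a)"
  have eq: "odd_theta q a = (1 - a\<^sup>2 * q powi (- m)) * u a" if "a \<noteq> 0" for a
  proof -
    define y where "y = a\<^sup>2 * q powi (- m)"
    have y: "y \<noteq> 0" "a\<^sup>2 = y * q powi m" using that q by (auto simp: y_def power_int_minus)
    have "theta0 q (a\<^sup>2) = (- 1 / y) powi m * q powi (- binom2 m) * theta0 q y"
      unfolding y(2) by (rule theta0_shift[OF q y(1)])
    also have "theta0 q y = (1 - y) * (qpoch_inf (y * q) q * qpoch_inf (q / y) q)"
      unfolding theta0_def by (subst qpoch_inf_step[OF q(1)]) simp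
    finally show ?thesis unfolding odd_theta_def u_def y_def[symmetric] by (simp add: mult_ac)
  qed
  have y1: "\<alpha>\<^sup>2 * q powi (- m) = 1" unfolding m using q by (simp add: power_int_minus)
  have "u holomorphic_on - {0}"
    unfolding u_def using q by (intro holomorphic_intros) auto
  hence du: "(u has_field_derivative deriv u \<alpha>) (at \<alpha>)"
    using \<alpha>(1) by (intro holomorphic_derivI[of _ "- {0}"]) auto
  have "((\<lambda>a. (1 - a\<^sup>2 * q powi (- m)) * u a) has_field_derivative
      (- (2 * \<alpha> * q powi (- m))) * u \<alpha>) (at \<alpha>)"
    using du y1 by (auto intro!: derivative_eq_intros)
  hence "(odd_theta q has_field_derivative (- (2 * \<alpha> * q powi (- m))) * u \<alpha>) (at \<alpha>)"
    by (rule has_field_derivative_transform_within_open[where S = "- {0}"])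
       (use \<alpha> eq in auto)
  moreover have "u \<alpha> \<noteq> 0"
    unfolding u_def y1 using \<alpha> q qpoch_inf_self_neq_0[OF q(1)] by simp
  ultimately show ?thesis using that[OF m] \<alpha> q by simp
qed

lemma odd_theta_holomorphic:
  assumes "norm q < 1"
  shows "odd_theta q holomorphic_on - {0}"
  unfolding odd_theta_def[abs_def] theta0_def using assms by (intro holomorphic_intros) auto

lemma quasi_periodic_shift:
  fixes F :: "complex \<Rightarrow> complex"
  assumes q: "q \<noteq> 0"
    and F: "\<And>\<alpha>. \<alpha> \<noteq> 0 \<Longrightarrow> F (\<alpha> * q) = F \<alpha> / (q\<^sup>2 * \<alpha> ^ 4)" and \<alpha>: "\<alpha> \<noteq> 0"
  shows "F (\<alpha> * q powi j) = q powi (- 2 * j\<^sup>2) * \<alpha> powi (- 4 * j) * F \<alpha>"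
proof (induction j rule: int_induct[where k = 0])
  case base
  thus ?case by simp
next
  case (step1 i)
  have "F (\<alpha> * q powi (i + 1)) = F (\<alpha> * q powi i) / (q\<^sup>2 * (\<alpha> * q powi i) ^ 4)"
    using F[of "\<alpha> * q powi i"] \<alpha> q by (simp add: power_int_add mult.assoc)
  also have "(\<alpha> * q powi i) ^ 4 = \<alpha> powi 4 * q powi (4 * i)"
    by (simp add: power_mult_distrib power_int_mult mult.commute[of 4 i])
  also have "q\<^sup>2 = q powi 2" by simp
  also have "F (\<alpha> * q powi i) / (q powi 2 * (\<alpha> powi 4 * q powi (4 * i))) =
      (q powi (- 2 * i\<^sup>2) / (q powi 2 * q powi (4 * i))) * (\<alpha> powi (- 4 * i) / \<alpha> powi 4) * F \<alpha>"
    unfolding step1(2) by simp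
  also have "q powi (- 2 * i\<^sup>2) / (q powi 2 * q powi (4 * i)) = q powi (- 2 * (i + 1)\<^sup>2)"
  proof -
    have "- 2 * i\<^sup>2 - (2 + 4 * i) = - 2 * (i + 1)\<^sup>2" by (simp add: power2_eq_square algebra_simps)
    thus ?thesis using q by (metis power_int_add power_int_diff)
  qed
  also have "\<alpha> powi (- 4 * i) / \<alpha> powi 4 = \<alpha> powi (- 4 * (i + 1))"
  proof -
    have "- 4 * i - 4 = - 4 * (i + 1)" by (simp add: algebra_simps)
    thus ?thesis using \<alpha> by (metis power_int_diff)
  qed
  finally show ?case .
next
  case (step2 i)
  have "F (\<alpha> * q powi i) = F (\<alpha> * q powi (i - 1)) / (q\<^sup>2 * (\<alpha> * q powi (i - 1)) ^ 4)"
    using F[of "\<alpha> * q powi (i - 1)"] \<alpha> q by (simp add: power_int_diff)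
  hence "F (\<alpha> * q powi (i - 1)) = F (\<alpha> * q powi i) * (q\<^sup>2 * (\<alpha> * q powi (i - 1)) ^ 4)"
    using \<alpha> q by simp
  also have "(\<alpha> * q powi (i - 1)) ^ 4 = \<alpha> powi 4 * q powi (4 * (i - 1))"
    using power_int_mult[of q "i - 1" 4] by (simp add: power_mult_distrib algebra_simps)
  also have "q\<^sup>2 = q powi 2" by simp
  also have "F (\<alpha> * q powi i) * (q powi 2 * (\<alpha> powi 4 * q powi (4 * (i - 1)))) =
      (q powi (- 2 * i\<^sup>2) * (q powi 2 * q powi (4 * (i - 1)))) * (\<alpha> powi (- 4 * i) * \<alpha> powi 4) * F \<alpha>"
    unfolding step2(2) by (simp only: mult_ac)
  also have "q powi (- 2 * i\<^sup>2) * (q powi 2 * q powi (4 * (i - 1))) = q powi (- 2 * (i - 1)\<^sup>2)"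
  proof -
    have "- 2 * i\<^sup>2 + (2 + 4 * (i - 1)) = - 2 * (i - 1)\<^sup>2" by (simp add: power2_eq_square algebra_simps)
    thus ?thesis using q by (metis power_int_add)
  qed
  also have "\<alpha> powi (- 4 * i) * \<alpha> powi 4 = \<alpha> powi (- 4 * (i - 1))"
    using \<alpha> by (subst power_int_add[symmetric]) (simp_all add: algebra_simps)
  finally show ?case .
qed

text \<open>
  If \<open>\<alpha>\<^sup>2 = q\<^sup>m\<close>, then \<open>1/\<alpha> = \<alpha> q\<^sup>-\<^sup>m\<close>, and the multiplier of \<open>F\<close> for this shift is \<open>1\<close>; since \<open>F\<close> is odd
  it vanishes at \<open>\<alpha>\<close>. These points are the zeros of \<open>odd_theta q\<close>, which are simple, so the quotient has
  no poles. As a function of \<open>log \<alpha>\<close> it has the periods \<open>2\<pi>i\<close> and \<open>log q\<close>. It is therefore bounded by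
  its maximum on a compact set that meets all orbits of the period lattice, and hence constant.
\<close>

lemma odd_quasi_periodic_eq_odd_theta:
  fixes F :: "complex \<Rightarrow> complex"
  assumes q: "0 < norm q" "norm q < 1"
    and hol: "F holomorphic_on - {0}"
    and per: "\<And>\<alpha>. \<alpha> \<noteq> 0 \<Longrightarrow> F (\<alpha> * q) = F \<alpha> / (q\<^sup>2 * \<alpha> ^ 4)"
    and odd: "\<And>\<alpha>. \<alpha> \<noteq> 0 \<Longrightarrow> F (1 / \<alpha>) = - F \<alpha>"
  obtains \<kappa> where "\<And>\<alpha>. \<alpha> \<noteq> 0 \<Longrightarrow> F \<alpha> = \<kappa> * odd_theta q \<alpha>"
proof -
  have q0: "q \<noteq> 0" using q by auto
  define f where "f = (\<lambda>z. F (exp z))"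
  define g where "g = (\<lambda>z. odd_theta q (exp z))"
  have zero: "F \<alpha> = 0" if "\<alpha> \<noteq> 0" "\<alpha>\<^sup>2 = q powi m" for \<alpha> m
  proof -
    have "\<alpha> powi (4 * m) = (\<alpha>\<^sup>2) powi (2 * m)"
      using power_int_mult[of \<alpha> 2 "2 * m"] by simp
    also have "\<dots> = q powi (2 * m\<^sup>2)"
      unfolding that(2) by (simp add: power_int_mult[symmetric] power2_eq_square mult_ac)
    finally have "q powi (- 2 * (- m)\<^sup>2) * \<alpha> powi (- 4 * (- m)) = 1"
      using q0 by (simp add: power_int_minus)
    moreover have "\<alpha> * q powi (- m) = 1 / \<alpha>"
      using that q0 by (simp add: power_int_minus that(2)[symmetric] power2_eq_square field_simps)
    ultimately have "F (1 / \<alpha>) = F \<alpha>"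
      using quasi_periodic_shift[of q F \<alpha> "- m", OF q0 per that(1)] by simp
    thus ?thesis using odd[OF that(1)] by simp
  qed
  have f: "f holomorphic_on UNIV"
    unfolding f_def using holomorphic_on_compose_gen[OF holomorphic_on_exp hol, of UNIV, unfolded o_def] by force
  have g: "g holomorphic_on UNIV"
    unfolding g_def
    using holomorphic_on_compose_gen[OF holomorphic_on_exp odd_theta_holomorphic[OF q(2)], of UNIV, unfolded o_def]
    by force
  have fz: "f z = 0" if "g z = 0" for z
    using odd_theta_simple_zeros[OF q(2) q0, of "exp z"] that zero unfolding f_def g_def
    by (metis exp_not_eq_zero)
  have gz: "deriv g z \<noteq> 0" if gz0: "g z = 0" for z
  proof -
    obtain D where D: "(odd_theta q has_field_derivative D) (at (exp z))" "D \<noteq> 0"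
      using odd_theta_simple_zeros[OF q(2) q0, of "exp z"] gz0 unfolding g_def
      by (metis exp_not_eq_zero)
    have "(g has_field_derivative D * exp z) (at z)"
      unfolding g_def using DERIV_chain2[OF D(1) DERIV_exp] .
    thus ?thesis using D(2) DERIV_imp_deriv by fastforce
  qed
  obtain G where G: "G holomorphic_on UNIV" "\<And>z. f z = G z * g z"
      "\<And>z. eventually (\<lambda>w. g w \<noteq> 0) (at z)"
    using holomorphic_quotient_simple_zeros[OF f g fz gz] by metis
  have contG: "continuous_on UNIV G" using G(1) by (rule holomorphic_on_imp_continuous_on)
  \<comment> \<open>Not the period parallelogram, but every orbit of the period lattice meets this rectangle: a
    multiple of \<open>log q\<close> adjusts the real part, then one of \<open>2\<pi>i\<close> the imaginary part.\<close>
  define K where "K = cbox (Complex (ln (norm q)) 0) (Complex 0 (2 * pi))"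
  have "compact (G ` K)"
    unfolding K_def by (intro compact_continuous_image continuous_on_subset[OF contG]) auto
  then obtain M where M: "\<And>z. z \<in> K \<Longrightarrow> norm (G z) \<le> M"
    using compact_imp_bounded bounded_iff by (metis imageI)
  have bd1: "norm (G z) \<le> M" if gz: "g z \<noteq> 0" for z
  proof -
    have lnq: "ln (norm q) < 0" using q by simp
    define m where "m = \<lfloor>Re z / ln (norm q)\<rfloor>"
    define z1 where "z1 = z - of_int m * Ln q"
    define l where "l = \<lfloor>Im z1 / (2 * pi)\<rfloor>"
    define z2 where "z2 = z1 - of_int l * (of_real (2 * pi) * \<i>)"
    have "exp (of_int l * (of_real (2 * pi) * \<i>)) = 1"
      using exp_integer_2pi[of "of_int l"] by (simp add: mult_ac)
    hence "exp z2 = exp z1" unfolding z2_def by (simp add: exp_diff)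
    also have "exp z1 = exp z * q powi (- m)"
    proof -
      have "exp (of_int m * Ln q) = q powi m"
        using exp_power_int[of "Ln q" m] q0 by (simp add: mult.commute)
      thus ?thesis unfolding z1_def by (simp add: exp_diff power_int_minus divide_inverse)
    qed
    finally have ez: "exp z2 = exp z * q powi (- m)" .
    have "Re z2 = Re z - m * ln (norm q)"
      by (simp add: z2_def z1_def Re_Ln q0)
    moreover have "of_int m \<le> Re z / ln (norm q)" "Re z / ln (norm q) \<le> of_int m + 1"
      unfolding m_def by linarith+
    ultimately have re: "ln (norm q) \<le> Re z2" "Re z2 \<le> 0"
      using lnq by (auto simp: field_simps)
    have "Im z2 = Im z1 - l * (2 * pi)" by (simp add: z2_def)
    moreover have "of_int l \<le> Im z1 / (2 * pi)" "Im z1 / (2 * pi) \<le> of_int l + 1"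
      unfolding l_def by linarith+
    ultimately have im: "0 \<le> Im z2" "Im z2 \<le> 2 * pi"
      by (auto simp: field_simps)
    have "z2 \<in> K" using re im by (auto simp: K_def in_cbox_complex_iff)
    define c where "c = q powi (- 2 * (- m)\<^sup>2) * exp z powi (- 4 * (- m))"
    have c: "c \<noteq> 0" using q0 by (simp add: c_def)
    have "f z2 = c * f z"
      unfolding f_def ez c_def by (rule quasi_periodic_shift[OF q0 per]) auto
    moreover have "g z2 = c * g z"
      unfolding g_def ez c_def by (rule quasi_periodic_shift[OF q0 odd_theta_mult[OF q(2) q0]]) auto
    ultimately have "G z2 * (c * g z) = c * (G z * g z)" using G(2) by metis
    hence "G z2 = G z" using c gz by simp
    thus ?thesis using M[OF \<open>z2 \<in> K\<close>] by simp
  qed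
  have "norm (G z) \<le> M" for z
  proof (rule tendsto_upperbound)
    show "((\<lambda>w. norm (G w)) \<longlongrightarrow> norm (G z)) (at z)"
      using contG by (intro tendsto_norm) (auto simp: continuous_on_def)
    show "eventually (\<lambda>w. norm (G w) \<le> M) (at z)"
      using G(3)[of z] by eventually_elim (rule bd1)
  qed auto
  hence "bounded (range G)" by (auto simp: bounded_iff)
  then obtain \<kappa> where \<kappa>: "\<And>z. G z = \<kappa>"
    using Liouville_theorem[OF G(1)] by (auto simp: constant_on_def)
  have "F \<alpha> = \<kappa> * odd_theta q \<alpha>" if "\<alpha> \<noteq> 0" for \<alpha>
    using G(2)[of "Ln \<alpha>"] \<kappa> that by (simp add: f_def g_def)
  thus ?thesis using that by blast
qed

section \<open>Quasi-periodicity, special values and contiguous relations of the sum\<close>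

text \<open>
  The quadratic exponent was arranged so that replacing \<open>\<alpha>\<close> by \<open>\<alpha>q\<close> shifts the summation index by \<open>1\<close>.
\<close>

lemma kernel_sum_mult:
  assumes "q \<noteq> 0" "\<alpha> \<noteq> 0"
  shows "kernel_sum q k B C (\<alpha> * q) = kernel_sum q k B C \<alpha> / (q\<^sup>2 * \<alpha> ^ 4)"
proof -
  have "kernel_term q k B C (\<alpha> * q) n = kernel_term q k B C \<alpha> (n + 1) / (q\<^sup>2 * \<alpha> ^ 4)" for n
  proof -
    have "\<alpha> * q * q powi n = \<alpha> * q powi (n + 1)"
      using assms by (simp add: power_int_add)
    moreover have "(\<alpha> * q) powi (4 * n) * q powi (2 * n\<^sup>2) * (q powi 2 * \<alpha> powi 4) =
        \<alpha> powi (4 * (n + 1)) * q powi (2 * (n + 1)\<^sup>2)"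
    proof -
      have "\<alpha> powi (4 * n) * \<alpha> powi 4 = \<alpha> powi (4 * (n + 1))"
        using assms by (simp add: power_int_add[symmetric] algebra_simps del: power_int_numeral)
      moreover have "4 * n + 2 * n\<^sup>2 + 2 = 2 * (n + 1)\<^sup>2" by (simp add: power2_eq_square algebra_simps)
      hence "q powi (4 * n) * q powi (2 * n\<^sup>2) * q powi 2 = q powi (2 * (n + 1)\<^sup>2)"
        using assms by (metis power_int_add)
      moreover have "(\<alpha> * q) powi (4 * n) * q powi (2 * n\<^sup>2) * (q powi 2 * \<alpha> powi 4) =
          (\<alpha> powi (4 * n) * \<alpha> powi 4) * (q powi (4 * n) * q powi (2 * n\<^sup>2) * q powi 2)"
        by (simp only: power_int_mult_distrib mult_ac)
      ultimately show ?thesis by (simp only:)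
    qed
    ultimately show ?thesis
      using assms unfolding kernel_term_def by (simp add: field_simps)
  qed
  hence "kernel_sum q k B C (\<alpha> * q) = (\<Sum>\<^sub>\<infinity>n. kernel_term q k B C \<alpha> (n + 1) / (q\<^sup>2 * \<alpha> ^ 4))"
    unfolding kernel_sum_def by (intro infsum_cong)
  also have "\<dots> = (\<Sum>\<^sub>\<infinity>n. kernel_term q k B C \<alpha> (n + 1)) / (q\<^sup>2 * \<alpha> ^ 4)"
    using assms by (simp add: divide_inverse infsum_cmult_left')
  also have "(\<Sum>\<^sub>\<infinity>n. kernel_term q k B C \<alpha> (n + 1)) = kernel_sum q k B C \<alpha>"
    unfolding kernel_sum_def
    by (rule infsum_reindex_bij_betw) (auto intro!: bij_betwI[where g = "\<lambda>n. n - 1"])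
  finally show ?thesis .
qed

lemma kernel_sum_inverse: "kernel_sum q k B C (1 / \<alpha>) = - kernel_sum q k B C \<alpha>"
proof -
  have "kernel_sum q k B C (1 / \<alpha>) = (\<Sum>\<^sub>\<infinity>n. kernel_term q k B C (1 / \<alpha>) (- n))"
    unfolding kernel_sum_def
    by (rule infsum_reindex_bij_betw[symmetric]) (auto intro!: bij_betwI[where g = "\<lambda>n. - n"])
  also have "\<dots> = (\<Sum>\<^sub>\<infinity>n. - kernel_term q k B C \<alpha> n)"
    by (simp add: kernel_term_inverse)
  also have "\<dots> = - kernel_sum q k B C \<alpha>"
    unfolding kernel_sum_def by (rule infsum_uminus)
  finally show ?thesis .
qed

lemma kernel_sum_eq_odd_theta:
  assumes q: "0 < norm q" "norm q < 1" and nz: "B \<noteq> 0" "C \<noteq> 0"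
  obtains \<kappa> where "\<And>\<alpha>. \<alpha> \<noteq> 0 \<Longrightarrow> kernel_sum q k B C \<alpha> = \<kappa> * odd_theta q \<alpha>"
proof -
  have q0: "q \<noteq> 0" using q by auto
  have "(\<lambda>\<alpha>. kernel_sum q k B C \<alpha>) holomorphic_on - {0}"
    by (rule kernel_sum_holomorphic[OF q nz(2), where \<alpha> = "\<lambda>\<alpha>. \<alpha>" and B = "\<lambda>_. B"])
      (use nz in auto)
  from odd_quasi_periodic_eq_odd_theta[OF q this kernel_sum_mult[OF q0] kernel_sum_inverse]
  show ?thesis using that by metis
qed

lemma qpoch_inf_powi_eq_0:
  assumes "q \<noteq> 0" "norm q < 1" "m \<le> 0"
  shows "qpoch_inf (q powi m) q = 0"
proof -
  have "q powi m * q powi (- m) = 1" using assms by (simp add: power_int_minus)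
  hence "q powi m * q ^ nat (- m) = 1" using assms(3) by (simp add: power_int_def)
  thus ?thesis using qpoch_inf_eq_0_iff[OF assms(2)] by blast
qed

text \<open>
  At \<open>\<alpha> = B\<close> the factors \<open>B q\<^sup>k\<^sup>+\<^sup>1 / x\<close> and \<open>(q / B) x\<close> become \<open>q\<^sup>k\<^sup>+\<^sup>1\<^sup>-\<^sup>n\<close> and \<open>q\<^sup>n\<^sup>+\<^sup>1\<close>. Their products
  vanish for \<open>n \<ge> k + 1\<close> and for \<open>n \<le> -1\<close>, respectively, which leaves only the indices with
  \<open>0 \<le> n \<le> k\<close>.
\<close>

lemma kernel_term_at_pole:
  assumes q: "q \<noteq> 0" "norm q < 1" and B: "B \<noteq> 0" and k: "k \<le> 0" "k < 0 \<or> n \<noteq> 0"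
  shows "kernel_term q k B C B n = 0"
proof (cases "n \<ge> k + 1")
  case True
  have "B * q powi (k + 1) / (B * q powi n) = q powi (k + 1 - n)"
    using B q by (simp add: power_int_diff)
  moreover have "qpoch_inf (q powi (k + 1 - n)) q = 0"
    using True by (intro qpoch_inf_powi_eq_0 q) auto
  ultimately have "qpoch_sym (B * q powi (k + 1)) (B * q powi n) q = 0"
    unfolding qpoch_sym_def by simp
  thus ?thesis by (simp add: kernel_term_def kernel_def)
next
  case False
  hence n: "n \<le> - 1" using k by auto
  have "q / B * (B * q powi n) = q powi (n + 1)"
    using B q by (simp add: power_int_add)
  moreover have "qpoch_inf (q powi (n + 1)) q = 0"
    using n by (intro qpoch_inf_powi_eq_0 q) auto
  ultimately have "qpoch_sym (q / B) (B * q powi n) q = 0"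
    unfolding qpoch_sym_def by simp
  thus ?thesis by (simp add: kernel_term_def kernel_def)
qed

lemma kernel_sum_eq_0:
  assumes q: "0 < norm q" "norm q < 1" and nz: "B \<noteq> 0" "C \<noteq> 0" "\<alpha> \<noteq> 0" and k: "k < 0"
    and B: "odd_theta q B \<noteq> 0"
  shows "kernel_sum q k B C \<alpha> = 0"
proof -
  have q0: "q \<noteq> 0" using q by auto
  obtain \<kappa> where \<kappa>: "\<And>\<alpha>. \<alpha> \<noteq> 0 \<Longrightarrow> kernel_sum q k B C \<alpha> = \<kappa> * odd_theta q \<alpha>"
    using kernel_sum_eq_odd_theta[OF q nz(1,2)] by blast
  have "kernel_sum q k B C B = 0"
    unfolding kernel_sum_def using k by (intro infsum_0 kernel_term_at_pole[OF q0 q(2) nz(1)]) auto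
  hence "\<kappa> = 0" using \<kappa>[OF nz(1)] B by simp
  thus ?thesis using \<kappa>[OF nz(3)] by simp
qed

text \<open>
  The ratio of the bilateral sum to \<open>odd_theta q \<alpha>\<close>. Its factors are arranged so that \<open>B\<close>
  occurs in no denominator other than in powers of \<open>B\<close>: thus \<open>(B\<^sup>2 q\<^sup>2\<^sup>k\<^sup>+\<^sup>1; q\<^sup>2)\<close> stands for the
  quotient of \<open>(B\<^sup>2 q; q\<^sup>2)\<close> by its first \<open>k\<close> factors, and the first line is \<open>(q / (BC); q)\<close> times
  \<open>(BC; q)\<^sub>k\<close> and a monomial. The constant is then continuous for all \<open>B \<noteq> 0\<close>.
\<close>

definition theta_coeff :: "complex \<Rightarrow> nat \<Rightarrow> complex \<Rightarrow> complex \<Rightarrow> complex" where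
  "theta_coeff q k B C =
     (q powi (- binom2 (int k)) * qpoch_inf (q powi (1 - int k) / (B * C)) q) *
     (qpoch (B / C) q (int k) * qpoch_inf (B * q / C) q * qpoch_inf (C\<^sup>2 * q\<^sup>2 / B\<^sup>2) (q\<^sup>2)) *
     (qpoch (C\<^sup>2 * q) (q\<^sup>2) (int k) / qpoch (C\<^sup>2 * q) q (int k) * qpoch_inf (C\<^sup>2 * q\<^sup>2) (q\<^sup>2)) *
     qpoch_inf (B\<^sup>2 * q ^ (2 * k + 1)) (q\<^sup>2) *
     ((qpoch_inf q q)\<^sup>2 / qpoch q q (int k) * qpoch_inf q (q\<^sup>2))"

lemma kernel_sum_0:
  assumes q: "0 < norm q" "norm q < 1" and nz: "B \<noteq> 0" "C \<noteq> 0" "\<alpha> \<noteq> 0"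
    and B: "odd_theta q B \<noteq> 0"
  shows "kernel_sum q 0 B C \<alpha> = theta_coeff q 0 B C * odd_theta q \<alpha>"
proof -
  have q0: "q \<noteq> 0" using q by auto
  obtain \<kappa> where \<kappa>: "\<And>\<alpha>. \<alpha> \<noteq> 0 \<Longrightarrow> kernel_sum q 0 B C \<alpha> = \<kappa> * odd_theta q \<alpha>"
    using kernel_sum_eq_odd_theta[OF q nz(1,2)] by blast
  have "kernel_sum q 0 B C B = (\<Sum>\<^sub>\<infinity>n\<in>{0}. kernel_term q 0 B C B n)"
    unfolding kernel_sum_def using kernel_term_at_pole[OF q0 q(2) nz(1), of 0]
    by (intro infsum_cong_neutral) auto
  also have "\<dots> = kernel q 0 B C B"
    by (simp add: kernel_term_def)
  also have "\<dots> = theta_coeff q 0 B C * odd_theta q B"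
  proof -
    have "odd_theta q B = (B - 1 / B) * (qpoch_inf (B\<^sup>2 * q) q * qpoch_inf (q / B\<^sup>2) q)"
      by (rule odd_theta_eq[OF q(2) nz(1)])
    moreover have "B * q * B = B\<^sup>2 * q" "B * q / B = q" "C\<^sup>2 * q\<^sup>2 / B * B = C\<^sup>2 * q\<^sup>2"
      "C\<^sup>2 * q\<^sup>2 / B / B = C\<^sup>2 * q\<^sup>2 / B\<^sup>2" "q / C * B = B * q / C" "q / C / B = q / (B * C)"
      "q / B * B = q" "q / B / B = q / B\<^sup>2"
      using nz by (auto simp: power2_eq_square mult_ac)
    ultimately show ?thesis
      unfolding kernel_def theta_coeff_def qpoch_sym_def by (simp add: power2_eq_square mult_ac)
  qed
  finally have "\<kappa> = theta_coeff q 0 B C" using \<kappa>[OF nz(1)] B by simp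
  thus ?thesis using \<kappa>[OF nz(3)] by simp
qed

text \<open>
  The factor \<open>j = 0\<close> of \<open>qpoch_sym w x p\<close>. Up to the constant \<open>w\<close> it is the difference of
  \<open>w + 1/w\<close> and \<open>x + 1/x\<close>, hence affine in \<open>x + 1/x\<close>.
\<close>

definition sym_factor :: "complex \<Rightarrow> complex \<Rightarrow> complex" where
  "sym_factor w x = (1 - w * x) * (1 - w / x)"

lemma sym_factor_eq: "w \<noteq> 0 \<Longrightarrow> x \<noteq> 0 \<Longrightarrow> sym_factor w x = w * ((w + 1 / w) - (x + 1 / x))"
  by (simp add: sym_factor_def field_simps)

lemma qpoch_sym_step: "norm p < 1 \<Longrightarrow> qpoch_sym w x p = sym_factor w x * qpoch_sym (w * p) x p"
  unfolding qpoch_sym_def sym_factor_def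
  by (subst qpoch_inf_step[of p "w * x"], assumption, subst qpoch_inf_step[of p "w / x"], assumption)
    (simp add: mult_ac)

definition joukowski :: "complex \<Rightarrow> complex" where "joukowski w = w + 1 / w"

text \<open>
  Divided by their common factors, the three kernels are multiples of \<open>s(P) - t\<close>, \<open>s(Q) - t\<close> and
  \<open>s(B) - t\<close>, where \<open>s(w) = w + 1/w\<close> and \<open>t = s(x)\<close>. The relation is the identity
  \<open>(s(Q) - s(B)) (s(P) - t) + (s(B) - s(P)) (s(Q) - t) + (s(P) - s(Q)) (s(B) - t) = 0\<close>.
\<close>

lemma kernel_contiguous:
  fixes k :: int
  assumes q: "q \<noteq> 0" "norm q < 1" and nz: "B \<noteq> 0" "C \<noteq> 0" "x \<noteq> 0"
  defines "P \<equiv> C * q powi k" and "Q \<equiv> B * q powi (k + 1)"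
  shows "(joukowski Q - joukowski B) * P * kernel q (k + 1) B C x + (joukowski B - joukowski P) / Q * kernel q k B C x +
      (joukowski P - joukowski Q) * B ^ 3 * q\<^sup>2 * kernel q (k - 1) (B * q\<^sup>2) (C * q) x = 0"
proof -
  define Z where "Z = q powi k"
  have Z: "Z \<noteq> 0" using q by (simp add: Z_def)
  have q2: "norm (q\<^sup>2) < 1" using q by (simp add: norm_power power_less_one_iff)
  have P: "P = C * Z" and Q: "Q = B * Z * q"
    using q by (simp_all add: P_def Q_def Z_def power_int_add)
  have PQ: "P \<noteq> 0" "Q \<noteq> 0" using P Q Z nz q by auto
  define Y where "Y = (x - 1 / x) * qpoch_sym (B * q ^ 3) x (q\<^sup>2) * qpoch_sym (C\<^sup>2 * q\<^sup>2 / B) x (q\<^sup>2) *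
     qpoch_sym (q / P) x q * qpoch_sym (Q * q) x q * qpoch_sym (q / B) x q"
  have s1: "qpoch_sym (B * q) x (q\<^sup>2) = sym_factor (B * q) x * qpoch_sym (B * q ^ 3) x (q\<^sup>2)"
    by (subst qpoch_sym_step[OF q2]) (simp add: eval_nat_numeral mult_ac)
  have s2: "qpoch_sym Q x q = sym_factor Q x * qpoch_sym (Q * q) x q"
    by (rule qpoch_sym_step[OF q(2)])
  have s3: "qpoch_sym (1 / P) x q = sym_factor (1 / P) x * qpoch_sym (q / P) x q"
    by (subst qpoch_sym_step[OF q(2)]) simp
  have s4: "qpoch_sym (1 / (B * q)) x q = sym_factor (1 / (B * q)) x * (sym_factor (1 / B) x * qpoch_sym (q / B) x q)"
    using q by (subst qpoch_sym_step[OF q(2)], subst qpoch_sym_step[OF q(2)]) simp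
  have c0: "kernel q k B C x = sym_factor (B * q) x * sym_factor Q x * Y"
  proof -
    have "q powi (1 - k) / C = q / P" using q by (simp add: P Z_def power_int_diff)
    thus ?thesis unfolding kernel_def Q_def[symmetric] s1 s2 Y_def by (simp add: mult_ac)
  qed
  have c1: "kernel q (k + 1) B C x = sym_factor (B * q) x * sym_factor (1 / P) x * Y"
  proof -
    have e1: "q powi (1 - (k + 1)) / C = 1 / P" using q by (simp add: P Z_def power_int_minus field_simps)
    have e2: "B * q powi (k + 1 + 1) = Q * q"
      using q by (simp add: Q Z_def power_int_add power2_eq_square mult_ac)
    show ?thesis unfolding kernel_def e1 e2 s1 s3 Y_def by (simp only: mult_ac)
  qed
  have c2: "kernel q (k - 1) (B * q\<^sup>2) (C * q) x = sym_factor (1 / (B * q)) x * sym_factor (1 / B) x * Y"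
  proof -
    have e1: "q powi (1 - (k - 1)) / (C * q) = q / P"
      using q by (simp add: P Z_def power_int_diff power2_eq_square field_simps)
    have e2: "B * q\<^sup>2 * q powi (k - 1 + 1) = Q * q"
      using q by (simp add: Q Z_def power2_eq_square mult_ac)
    have e3: "B * q\<^sup>2 * q = B * q ^ 3"
      by (simp add: power2_eq_square power3_eq_cube)
    have e4: "(C * q)\<^sup>2 * q\<^sup>2 / (B * q\<^sup>2) = C\<^sup>2 * q\<^sup>2 / B"
      using q by (simp add: power_mult_distrib)
    have e5: "q / (B * q\<^sup>2) = 1 / (B * q)"
      using q by (simp add: power2_eq_square)
    show ?thesis unfolding kernel_def e1 e2 e3 e4 e5 s4 Y_def by (simp only: mult_ac)
  qed
  define t where "t = x + 1 / x"
  have h: "sym_factor (B * q) x = B * q * (joukowski (B * q) - t)" "sym_factor Q x = Q * (joukowski Q - t)"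
     "sym_factor (1 / P) x = 1 / P * (joukowski P - t)" "sym_factor (1 / (B * q)) x = 1 / (B * q) * (joukowski (B * q) - t)"
     "sym_factor (1 / B) x = 1 / B * (joukowski B - t)"
    using nz q PQ by (simp_all add: sym_factor_eq joukowski_def t_def add.commute)
  have e: "(joukowski Q - joukowski B) * P * (sym_factor (B * q) x * sym_factor (1 / P) x * Y) +
      (joukowski B - joukowski P) / Q * (sym_factor (B * q) x * sym_factor Q x * Y) +
      (joukowski P - joukowski Q) * B ^ 3 * q\<^sup>2 * (sym_factor (1 / (B * q)) x * sym_factor (1 / B) x * Y) =
      B * q * (joukowski (B * q) - t) * Y * ((joukowski Q - joukowski B) * (joukowski P - t) +
      (joukowski B - joukowski P) * (joukowski Q - t) + (joukowski P - joukowski Q) * (joukowski B - t))"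
  proof -
    have "(joukowski Q - joukowski B) * P * (sym_factor (B * q) x * sym_factor (1 / P) x * Y) =
        B * q * (joukowski (B * q) - t) * Y * ((joukowski Q - joukowski B) * (joukowski P - t))"
      unfolding h using PQ by (simp add: mult_ac)
    moreover have "(joukowski B - joukowski P) / Q * (sym_factor (B * q) x * sym_factor Q x * Y) =
        B * q * (joukowski (B * q) - t) * Y * ((joukowski B - joukowski P) * (joukowski Q - t))"
      unfolding h using PQ by (simp add: mult_ac)
    moreover have "(joukowski P - joukowski Q) * B ^ 3 * q\<^sup>2 * (sym_factor (1 / (B * q)) x * sym_factor (1 / B) x * Y) =
        B * q * (joukowski (B * q) - t) * Y * ((joukowski P - joukowski Q) * (joukowski B - t))"
      unfolding h using nz q by (simp add: eval_nat_numeral mult_ac)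
    ultimately show ?thesis by (simp only: distrib_left)
  qed
  have "(joukowski Q - joukowski B) * (joukowski P - t) + (joukowski B - joukowski P) * (joukowski Q - t) +
      (joukowski P - joukowski Q) * (joukowski B - t) = 0"
    by (simp add: algebra_simps)
  thus ?thesis unfolding c0 c1 c2 e by simp
qed

lemma kernel_sum_contiguous:
  fixes k :: int
  assumes q: "0 < norm q" "norm q < 1" and nz: "B \<noteq> 0" "C \<noteq> 0" "\<alpha> \<noteq> 0"
  defines "P \<equiv> C * q powi k" and "Q \<equiv> B * q powi (k + 1)"
  shows "(joukowski Q - joukowski B) * P * kernel_sum q (k + 1) B C \<alpha> + (joukowski B - joukowski P) / Q * kernel_sum q k B C \<alpha> +
      (joukowski P - joukowski Q) * B ^ 3 * q\<^sup>2 * kernel_sum q (k - 1) (B * q\<^sup>2) (C * q) \<alpha> = 0"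
    (is "?a * kernel_sum q (k + 1) B C \<alpha> + ?b * _ + ?c * _ = 0")
proof -
  have q0: "q \<noteq> 0" using q by auto
  have factor: "a * (M * u) + b * (M * v) + c * (M * w) = M * (a * u + b * v + c * w)"
    for a b c M u v w :: complex
    by (simp add: algebra_simps)
  define a b c where "a = ?a" and "b = ?b" and "c = ?c"
  have sum: "((\<lambda>n. a * kernel_term q (k + 1) B C \<alpha> n + b * kernel_term q k B C \<alpha> n +
      c * kernel_term q (k - 1) (B * q\<^sup>2) (C * q) \<alpha> n) has_sum
      (a * kernel_sum q (k + 1) B C \<alpha> + b * kernel_sum q k B C \<alpha> +
       c * kernel_sum q (k - 1) (B * q\<^sup>2) (C * q) \<alpha>)) UNIV"
    using nz q0 by (intro has_sum_add has_sum_cmult_right kernel_term_has_sum q) auto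
  have zero: "a * kernel_term q (k + 1) B C \<alpha> n + b * kernel_term q k B C \<alpha> n +
      c * kernel_term q (k - 1) (B * q\<^sup>2) (C * q) \<alpha> n = 0" for n
  proof -
    have "a * kernel q (k + 1) B C (\<alpha> * q powi n) + b * kernel q k B C (\<alpha> * q powi n) +
        c * kernel q (k - 1) (B * q\<^sup>2) (C * q) (\<alpha> * q powi n) = 0"
      unfolding a_def b_def c_def P_def Q_def
      by (rule kernel_contiguous[OF q0 q(2) nz(1,2)]) (use nz q0 in simp)
    thus ?thesis unfolding kernel_term_def factor by simp
  qed
  have "((\<lambda>_::int. 0) has_sum (a * kernel_sum q (k + 1) B C \<alpha> + b * kernel_sum q k B C \<alpha> +
       c * kernel_sum q (k - 1) (B * q\<^sup>2) (C * q) \<alpha>)) UNIV"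
    using sum unfolding zero .
  from infsumI[OF this] have "a * kernel_sum q (k + 1) B C \<alpha> + b * kernel_sum q k B C \<alpha> +
       c * kernel_sum q (k - 1) (B * q\<^sup>2) (C * q) \<alpha> = 0"
    by simp
  thus ?thesis unfolding a_def b_def c_def .
qed

section \<open>The closed form\<close>

lemma theta_coeff_Suc:
  fixes q B C :: complex and k :: nat
  assumes q: "0 < norm q" "norm q < 1" and nz: "B \<noteq> 0" "C \<noteq> 0"
    and gen: "1 - C\<^sup>2 * q ^ (k + 1) \<noteq> 0" "1 - B\<^sup>2 * q ^ (2 * k + 1) \<noteq> 0"
  defines "X \<equiv> q ^ k"
  shows "theta_coeff q (Suc k) B C = - ((1 - B * C * X) * (1 - B * X / C) * (1 - C\<^sup>2 * q * X\<^sup>2)) /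
     (B * C * X\<^sup>2 * (1 - q * X) * (1 - C\<^sup>2 * q * X) * (1 - B\<^sup>2 * q * X\<^sup>2)) * theta_coeff q k B C"
proof -
  have q0: "q \<noteq> 0" using q by auto
  have X: "X \<noteq> 0" using q0 by (simp add: X_def)
  have q2: "norm (q\<^sup>2) < 1" using q by (simp add: norm_power power_less_one_iff)
  have qX: "1 - q * X \<noteq> 0" using power_neq_1[OF q(2), of "Suc k"] by (simp add: X_def)
  have gen': "1 - C\<^sup>2 * q * X \<noteq> 0" "1 - B\<^sup>2 * q * X\<^sup>2 \<noteq> 0"
  proof -
    have e1: "q ^ (2 * k + 1) = q * X\<^sup>2" by (simp add: X_def power_mult[symmetric] mult.commute)
    have e2: "q ^ (k + 1) = q * X" by (simp add: X_def)
    show "1 - C\<^sup>2 * q * X \<noteq> 0" "1 - B\<^sup>2 * q * X\<^sup>2 \<noteq> 0"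
      using gen unfolding e1 e2 by (simp_all add: mult.assoc)
  qed
  define y where "y = B * C"
  have y: "y \<noteq> 0" using nz by (simp add: y_def)
  have g1: "q powi (- binom2 (int (Suc k))) * qpoch_inf (q powi (1 - int (Suc k)) / y) q =
     - (1 - y * X) / (y * X\<^sup>2) * (q powi (- binom2 (int k)) * qpoch_inf (q powi (1 - int k) / y) q)"
  proof -
    have "binom2 (int (Suc k)) = binom2 (int k) + int k" using binom2_add_1[of "int k"] by (simp add: add.commute)
    hence 1: "q powi (- binom2 (int (Suc k))) = q powi (- binom2 (int k)) / X"
      using q0 by (simp add: X_def power_int_diff)
    have 2: "q powi (1 - int (Suc k)) / y = 1 / (y * X)"
      using q0 y by (simp add: X_def power_int_minus field_simps)
    have 3: "1 / (y * X) * q = q powi (1 - int k) / y"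
      using q0 by (simp add: X_def power_int_diff field_simps)
    have "qpoch_inf (1 / (y * X)) q = (1 - 1 / (y * X)) * qpoch_inf (q powi (1 - int k) / y) q"
      using qpoch_inf_step[OF q(2), of "1 / (y * X)"] unfolding 3 .
    moreover have "1 - 1 / (y * X) = - (1 - y * X) / (y * X)"
      using y X by (simp add: field_simps)
    ultimately show ?thesis unfolding 1 2 using X y by (simp add: power2_eq_square mult_ac)
  qed
  have g3: "qpoch (B / C) q (int (Suc k)) = (1 - B * X / C) * qpoch (B / C) q (int k)"
    by (subst qpoch_Suc) (simp add: X_def)
  have g4: "qpoch (C\<^sup>2 * q) (q\<^sup>2) (int (Suc k)) / qpoch (C\<^sup>2 * q) q (int (Suc k)) =
     (1 - C\<^sup>2 * q * X\<^sup>2) / (1 - C\<^sup>2 * q * X) *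
     (qpoch (C\<^sup>2 * q) (q\<^sup>2) (int k) / qpoch (C\<^sup>2 * q) q (int k))"
    by (subst (1 2) qpoch_Suc) (simp add: X_def power_mult[symmetric] mult_ac)
  have g5: "qpoch_inf (B\<^sup>2 * q ^ (2 * Suc k + 1)) (q\<^sup>2) =
     1 / (1 - B\<^sup>2 * q * X\<^sup>2) * qpoch_inf (B\<^sup>2 * q ^ (2 * k + 1)) (q\<^sup>2)"
  proof -
    have f1: "B\<^sup>2 * q ^ (2 * k + 1) = B\<^sup>2 * q * X\<^sup>2"
      by (simp add: X_def power2_eq_square mult_2_right power_add mult_ac)
    have f2: "B\<^sup>2 * q ^ (2 * Suc k + 1) = B\<^sup>2 * q * X\<^sup>2 * q\<^sup>2"
      by (simp add: X_def power2_eq_square mult_2_right power_add mult_ac)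
    show ?thesis
      unfolding f1 f2 using gen'(2) qpoch_inf_step[OF q2, of "B\<^sup>2 * q * X\<^sup>2"] by simp
  qed
  have g6: "(qpoch_inf q q)\<^sup>2 / qpoch q q (int (Suc k)) = 1 / (1 - q * X) * ((qpoch_inf q q)\<^sup>2 / qpoch q q (int k))"
    by (subst qpoch_Suc) (simp add: X_def)
  have "theta_coeff q (Suc k) B C = (- (1 - y * X) / (y * X\<^sup>2) * (1 - B * X / C) *
     ((1 - C\<^sup>2 * q * X\<^sup>2) / (1 - C\<^sup>2 * q * X)) * (1 / (1 - B\<^sup>2 * q * X\<^sup>2)) * (1 / (1 - q * X))) * theta_coeff q k B C"
    unfolding theta_coeff_def y_def[symmetric] g1 g3 g4 g5 g6 by (simp only: mult_ac)
  also have "- (1 - y * X) / (y * X\<^sup>2) * (1 - B * X / C) *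
     ((1 - C\<^sup>2 * q * X\<^sup>2) / (1 - C\<^sup>2 * q * X)) * (1 / (1 - B\<^sup>2 * q * X\<^sup>2)) * (1 / (1 - q * X)) =
     - ((1 - B * C * X) * (1 - B * X / C) * (1 - C\<^sup>2 * q * X\<^sup>2)) /
     (B * C * X\<^sup>2 * (1 - q * X) * (1 - C\<^sup>2 * q * X) * (1 - B\<^sup>2 * q * X\<^sup>2))"
    unfolding y_def by (simp only: times_divide_eq_left times_divide_eq_right divide_divide_eq_left
        mult_minus_left mult_minus_right divide_minus_left mult_1_right mult_1_left mult_ac)
  finally show ?thesis .
qed

lemma theta_coeff_shift:
  fixes q B C :: complex and j :: nat
  assumes q: "0 < norm q" "norm q < 1" and nz: "B \<noteq> 0" "C \<noteq> 0"
    and gen: "1 - C\<^sup>2 * q \<noteq> 0" "1 - C\<^sup>2 * q ^ (j + 2) \<noteq> 0" "1 - C\<^sup>2 * q\<^sup>2 \<noteq> 0"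
      "1 - B\<^sup>2 * q ^ (2 * j + 3) \<noteq> 0" "B \<noteq> C" "B * q \<noteq> C"
  defines "X \<equiv> q ^ Suc j"
  shows "theta_coeff q j (B * q\<^sup>2) (C * q) = - ((1 - B * C * X) * (1 - B * C * q * X) * (B + C) * (1 - X)) /
     (q\<^sup>2 * X * B ^ 4 * (C - B * q) * (1 - C\<^sup>2 * q * X) * (1 - B\<^sup>2 * q * X\<^sup>2)) * theta_coeff q (Suc j) B C"
proof -
  have q0: "q \<noteq> 0" using q by auto
  have X: "X \<noteq> 0" using q0 by (simp add: X_def)
  have q2: "norm (q\<^sup>2) < 1" using q by (simp add: norm_power power_less_one_iff)
  have X1: "1 - X \<noteq> 0" using power_neq_1[OF q(2), of "Suc j"] by (simp add: X_def)
  have gen': "1 - C\<^sup>2 * q * X \<noteq> 0" "1 - B\<^sup>2 * q * X\<^sup>2 \<noteq> 0"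
    using gen by (auto simp: X_def power2_eq_square power_add mult_ac mult_2 eval_nat_numeral)
  define y where "y = B * C"
  have y: "y \<noteq> 0" using nz by (simp add: y_def)
  have g1: "q powi (- binom2 (int j)) * qpoch_inf (q powi (1 - int j) / (B * q\<^sup>2 * (C * q))) q =
     (1 - y * X) * (1 - y * q * X) / (q\<^sup>2 * X * y\<^sup>2) *
       (q powi (- binom2 (int (Suc j))) * qpoch_inf (q powi (1 - int (Suc j)) / y) q)"
  proof -
    have "binom2 (int (Suc j)) = binom2 (int j) + int j" using binom2_add_1[of "int j"] by (simp add: add.commute)
    hence 1: "q powi (- binom2 (int j)) = q powi (- binom2 (int (Suc j))) * (X / q)"
      using q0 by (simp add: X_def power_int_diff)
    have 2: "q powi (1 - int j) / (B * q\<^sup>2 * (C * q)) = 1 / (y * X * q)"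
      using q0 nz by (simp add: X_def y_def power_int_diff power2_eq_square field_simps)
    have 3: "q powi (1 - int (Suc j)) / y = q / (y * X)"
      using q0 y by (simp add: X_def power_int_minus field_simps)
    have "qpoch_inf (1 / (y * X * q)) q = (1 - 1 / (y * X * q)) * ((1 - 1 / (y * X)) * qpoch_inf (q / (y * X)) q)"
      using qpoch_inf_step[OF q(2), of "1 / (y * X * q)"] qpoch_inf_step[OF q(2), of "1 / (y * X)"] q0 by simp
    moreover have "1 - 1 / (y * X) = - (1 - y * X) / (y * X)"
      using y X by (simp add: field_simps)
    moreover have "1 - 1 / (y * X * q) = - (1 - y * q * X) / (y * X * q)"
      using y X q0 by (simp add: field_simps)
    ultimately have "q powi (- binom2 (int j)) * qpoch_inf (1 / (y * X * q)) q = q powi (- binom2 (int (Suc j))) * (X / q) *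
        ((- (1 - y * q * X) / (y * X * q)) * ((- (1 - y * X) / (y * X)) * qpoch_inf (q / (y * X)) q))"
      unfolding 1 by (simp only:)
    also have "\<dots> = ((X / q) * (- (1 - y * q * X) / (y * X * q)) * (- (1 - y * X) / (y * X))) *
        (q powi (- binom2 (int (Suc j))) * qpoch_inf (q / (y * X)) q)"
      by (simp only: mult_ac)
    also have "(X / q) * (- (1 - y * q * X) / (y * X * q)) * (- (1 - y * X) / (y * X)) =
        (1 - y * X) * (1 - y * q * X) / (q\<^sup>2 * X * y\<^sup>2)"
      using X y q0 by (simp add: power2_eq_square) (simp add: field_simps)
    finally show ?thesis unfolding 2 3 .
  qed
  have g3: "qpoch (B * q\<^sup>2 / (C * q)) q (int j) * qpoch_inf (B * q\<^sup>2 * q / (C * q)) q *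
        qpoch_inf ((C * q)\<^sup>2 * q\<^sup>2 / (B * q\<^sup>2)\<^sup>2) (q\<^sup>2) =
     - (C * C * (B + C)) / (B * B * (C - B * q)) * (qpoch (B / C) q (int (Suc j)) * qpoch_inf (B * q / C) q *
        qpoch_inf (C\<^sup>2 * q\<^sup>2 / B\<^sup>2) (q\<^sup>2))"
  proof -
    have e: "B * q\<^sup>2 / (C * q) = B / C * q" "B * q\<^sup>2 * q / (C * q) = B * q / C * q"
      "(C * q)\<^sup>2 * q\<^sup>2 / (B * q\<^sup>2)\<^sup>2 = C\<^sup>2 / B\<^sup>2"
      using q0 by (simp_all add: power2_eq_square)
    have nz': "1 - B / C \<noteq> 0" "1 - B * q / C \<noteq> 0" "C - B \<noteq> 0" "C - B * q \<noteq> 0" using gen nz by auto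
    have a: "qpoch (B / C * q) q (int j) = qpoch (B / C) q (int (Suc j)) / (1 - B / C)"
      using qpoch_Suc_shift[of "B / C" q j] nz'(1) by simp
    have b: "qpoch_inf (B * q / C * q) q = qpoch_inf (B * q / C) q / (1 - B * q / C)"
      using qpoch_inf_step[OF q(2), of "B * q / C"] nz'(2) by simp
    have c: "qpoch_inf (C\<^sup>2 / B\<^sup>2) (q\<^sup>2) = (1 - C\<^sup>2 / B\<^sup>2) * qpoch_inf (C\<^sup>2 * q\<^sup>2 / B\<^sup>2) (q\<^sup>2)"
      using qpoch_inf_step[OF q2, of "C\<^sup>2 / B\<^sup>2"] by simp
    have d: "(1 - C\<^sup>2 / B\<^sup>2) / ((1 - B / C) * (1 - B * q / C)) = - (C * C * (B + C)) / (B * B * (C - B * q))"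
    proof -
      have "1 - C\<^sup>2 / B\<^sup>2 = (B - C) * (B + C) / (B * B)"
        using nz by (simp add: power2_eq_square field_simps)
      moreover have "1 - B / C = (C - B) / C" "1 - B * q / C = (C - B * q) / C"
        using nz by (simp_all add: field_simps)
      moreover have "B - C = - (C - B)" by simp
      ultimately have "(1 - C\<^sup>2 / B\<^sup>2) / ((1 - B / C) * (1 - B * q / C)) =
          (- (C - B) * (B + C) / (B * B)) / ((C - B) / C * ((C - B * q) / C))" by (simp only:)
      also have "\<dots> = - (C * C * (B + C)) / (B * B * (C - B * q))"
        using nz nz'(3,4) by (simp add: divide_simps) (simp add: algebra_simps)
      finally show ?thesis .
    qed
    show ?thesis unfolding e a b c d[symmetric] by simp
  qed
  have g4: "qpoch ((C * q)\<^sup>2 * q) (q\<^sup>2) (int j) / qpoch ((C * q)\<^sup>2 * q) q (int j) * qpoch_inf ((C * q)\<^sup>2 * q\<^sup>2) (q\<^sup>2) =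
     1 / (1 - C\<^sup>2 * q * X) *
     (qpoch (C\<^sup>2 * q) (q\<^sup>2) (int (Suc j)) / qpoch (C\<^sup>2 * q) q (int (Suc j)) * qpoch_inf (C\<^sup>2 * q\<^sup>2) (q\<^sup>2))"
  proof -
    have e: "(C * q)\<^sup>2 * q = C\<^sup>2 * q * q\<^sup>2" "(C * q)\<^sup>2 * q\<^sup>2 = C\<^sup>2 * q\<^sup>2 * q\<^sup>2"
      by (simp_all add: power_mult_distrib mult_ac)
    have a: "qpoch (C\<^sup>2 * q) (q\<^sup>2) (int (Suc j)) = (1 - C\<^sup>2 * q) * qpoch (C\<^sup>2 * q * q\<^sup>2) (q\<^sup>2) (int j)"
      by (rule qpoch_Suc_shift)
    have b1: "qpoch (C\<^sup>2 * q) q (int (Suc (Suc j))) = (1 - C\<^sup>2 * q) * ((1 - C\<^sup>2 * q\<^sup>2) * qpoch (C\<^sup>2 * q * q\<^sup>2) q (int j))"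
      by (subst qpoch_Suc_shift, subst qpoch_Suc_shift) (simp add: power2_eq_square mult_ac)
    have b2: "qpoch (C\<^sup>2 * q) q (int (Suc (Suc j))) = qpoch (C\<^sup>2 * q) q (int (Suc j)) * (1 - C\<^sup>2 * q * X)"
      by (subst qpoch_Suc) (simp add: X_def)
    have b: "qpoch (C\<^sup>2 * q) q (int (Suc j)) =
        (1 - C\<^sup>2 * q) * ((1 - C\<^sup>2 * q\<^sup>2) * qpoch (C\<^sup>2 * q * q\<^sup>2) q (int j)) / (1 - C\<^sup>2 * q * X)"
      unfolding nonzero_eq_divide_eq[OF gen'(1)] by (rule trans[OF b2[symmetric] b1])
    have c: "qpoch_inf (C\<^sup>2 * q\<^sup>2) (q\<^sup>2) = (1 - C\<^sup>2 * q\<^sup>2) * qpoch_inf (C\<^sup>2 * q\<^sup>2 * q\<^sup>2) (q\<^sup>2)"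
      by (rule qpoch_inf_step[OF q2])
    show ?thesis unfolding e a b c using gen(1,3) gen'(1) by simp
  qed
  have g5: "qpoch_inf ((B * q\<^sup>2)\<^sup>2 * q ^ (2 * j + 1)) (q\<^sup>2) =
     1 / (1 - B\<^sup>2 * q * X\<^sup>2) * qpoch_inf (B\<^sup>2 * q ^ (2 * Suc j + 1)) (q\<^sup>2)"
  proof -
    have f1: "B\<^sup>2 * q ^ (2 * Suc j + 1) = B\<^sup>2 * q * X\<^sup>2"
      by (simp add: X_def power2_eq_square mult_2_right power_add mult_ac)
    have f2: "(B * q\<^sup>2)\<^sup>2 * q ^ (2 * j + 1) = B\<^sup>2 * q * X\<^sup>2 * q\<^sup>2"
      by (simp add: X_def power2_eq_square mult_2_right power_add mult_ac)
    show ?thesis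
      unfolding f1 f2 using gen'(2) qpoch_inf_step[OF q2, of "B\<^sup>2 * q * X\<^sup>2"] by simp
  qed
  have g6: "(qpoch_inf q q)\<^sup>2 / qpoch q q (int j) = (1 - X) * ((qpoch_inf q q)\<^sup>2 / qpoch q q (int (Suc j)))"
    using X1 by (subst qpoch_Suc) (simp add: X_def)
  have "theta_coeff q j (B * q\<^sup>2) (C * q) =
     ((1 - y * X) * (1 - y * q * X) / (q\<^sup>2 * X * y\<^sup>2) * (- (C * C * (B + C)) / (B * B * (C - B * q))) *
      (1 / (1 - C\<^sup>2 * q * X)) * (1 / (1 - B\<^sup>2 * q * X\<^sup>2)) * (1 - X)) * theta_coeff q (Suc j) B C"
    unfolding theta_coeff_def g1 g3 g4 g5 g6 y_def[symmetric] by (simp only: mult_ac)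
  also have "(1 - y * X) * (1 - y * q * X) / (q\<^sup>2 * X * y\<^sup>2) * (- (C * C * (B + C)) / (B * B * (C - B * q))) *
      (1 / (1 - C\<^sup>2 * q * X)) * (1 / (1 - B\<^sup>2 * q * X\<^sup>2)) * (1 - X) =
      - ((1 - B * C * X) * (1 - B * C * q * X) * (B + C) * (1 - X)) /
     (q\<^sup>2 * X * B ^ 4 * (C - B * q) * (1 - C\<^sup>2 * q * X) * (1 - B\<^sup>2 * q * X\<^sup>2))"
    using nz unfolding y_def by (simp add: power2_eq_square eval_nat_numeral mult_ac)
  finally show ?thesis .
qed


text \<open>
  By \<open>theta_coeff_Suc\<close> and \<open>theta_coeff_shift\<close> all three terms are explicit rational multiples of
  \<open>theta_coeff q k B C\<close>, and the claim becomes a polynomial identity in \<open>B\<close>, \<open>C\<close>, \<open>q\<close> and \<open>X = q\<^sup>k\<close>. For \<open>k = 0\<close>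
  the multiplier of the third term contains the factor \<open>1 - X = 0\<close>, in accordance with the vanishing
  of the sum for negative \<open>k\<close>.
\<close>

lemma theta_coeff_contiguous:
  fixes q B C :: complex and k :: nat
  assumes q: "0 < norm q" "norm q < 1" and nz: "B \<noteq> 0" "C \<noteq> 0"
    and C: "\<And>i. i \<in> {1..Suc k} \<Longrightarrow> C\<^sup>2 * q ^ i \<noteq> 1"
    and B: "\<And>i. B\<^sup>2 * q ^ i \<noteq> 1" "B \<noteq> C" "B * q \<noteq> C"
  defines "P \<equiv> C * q ^ k" and "Q \<equiv> B * q ^ (k + 1)"
  shows "(joukowski Q - joukowski B) * P * theta_coeff q (Suc k) B C + (joukowski B - joukowski P) / Q * theta_coeff q k B C +
      (joukowski P - joukowski Q) * B ^ 3 * q\<^sup>2 * (if k = 0 then 0 else theta_coeff q (k - 1) (B * q\<^sup>2) (C * q)) = 0"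
proof -
  have q0: "q \<noteq> 0" using q by auto
  define X where "X = q ^ k"
  have X: "X \<noteq> 0" using q0 by (simp add: X_def)
  have qX: "1 - q * X \<noteq> 0" using power_neq_1[OF q(2), of "Suc k"] by (simp add: X_def)
  have P: "P = C * X" and Q: "Q = B * q * X" by (simp_all add: P_def Q_def X_def)
  have e1: "q ^ (2 * k + 1) = q * X\<^sup>2" by (simp add: X_def power_mult[symmetric] mult.commute)
  have e2: "q ^ (k + 1) = q * X" by (simp add: X_def)
  have gen: "1 - C\<^sup>2 * q * X \<noteq> 0" "1 - B\<^sup>2 * q * X\<^sup>2 \<noteq> 0"
    using C[of "k + 1"] B(1)[of "2 * k + 1"] unfolding e1 e2 by (simp_all add: mult.assoc)
  define D where "D = (1 - C\<^sup>2 * q * X) * (1 - B\<^sup>2 * q * X\<^sup>2)"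
  have D: "D \<noteq> 0" using gen by (simp add: D_def)
  have CB: "C - B * q \<noteq> 0" using B(3) by auto
  define s where "s = - ((1 - B * C * X) * (1 - B * X / C) * (1 - C\<^sup>2 * q * X\<^sup>2)) /
     (B * C * X\<^sup>2 * (1 - q * X) * (1 - C\<^sup>2 * q * X) * (1 - B\<^sup>2 * q * X\<^sup>2))"
  define r where "r = - ((1 - B * C * X) * (1 - B * C * q * X) * (B + C) * (1 - X)) /
     (q\<^sup>2 * X * B ^ 4 * (C - B * q) * (1 - C\<^sup>2 * q * X) * (1 - B\<^sup>2 * q * X\<^sup>2))"
  have kS: "theta_coeff q (Suc k) B C = s * theta_coeff q k B C"
    unfolding s_def X_def using C[of "k + 1"] B(1)[of "2 * k + 1"]
    by (intro theta_coeff_Suc q nz) auto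
  have kr: "(if k = 0 then 0 else theta_coeff q (k - 1) (B * q\<^sup>2) (C * q)) = r * theta_coeff q k B C"
  proof (cases k)
    case 0
    thus ?thesis by (simp add: r_def X_def)
  next
    case (Suc j)
    have "theta_coeff q j (B * q\<^sup>2) (C * q) = r * theta_coeff q (Suc j) B C"
      unfolding r_def X_def Suc
      using C[of 1] C[of "j + 2"] C[of 2] B(1)[of "2 * j + 3"] B(2,3) Suc
      by (intro theta_coeff_shift q nz) auto
    thus ?thesis by (simp add: Suc)
  qed
  have c1: "(joukowski Q - joukowski B) * P * s = - ((1 - B * C * X) / (B\<^sup>2 * C * q * X\<^sup>2 * D)) *
      ((1 - B\<^sup>2 * q * X) * (C - B * X) * (1 - C\<^sup>2 * q * X\<^sup>2))"
  proof -
    have "joukowski Q - joukowski B = (1 - q * X) * (1 - B\<^sup>2 * q * X) / (B * q * X)"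
      unfolding Q joukowski_def using nz X q0 by (simp add: field_simps power2_eq_square)
    moreover have "1 - B * X / C = (C - B * X) / C" using nz by (simp add: field_simps)
    ultimately show ?thesis
      unfolding P s_def D_def using nz X q0 qX gen by (simp add: power2_eq_square mult_ac)
  qed
  have c0: "(joukowski B - joukowski P) / Q = - ((1 - B * C * X) / (B\<^sup>2 * C * q * X\<^sup>2 * D)) * ((B - C * X) * D)"
  proof -
    have "joukowski B - joukowski P = - ((B - C * X) * (1 - B * C * X) / (B * C * X))"
      unfolding P joukowski_def using nz X q0 by (simp add: field_simps)
    thus ?thesis unfolding Q using nz X q0 D by (simp add: power2_eq_square mult_ac)
  qed
  have c2: "(joukowski P - joukowski Q) * B ^ 3 * q\<^sup>2 * r = (1 - B * C * X) / (B\<^sup>2 * C * q * X\<^sup>2 * D) *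
      ((1 - B * C * q * X\<^sup>2) * (1 - B * C * q * X) * (B + C) * (1 - X))"
  proof -
    have "joukowski P - joukowski Q = - ((C - B * q) * (1 - B * C * q * X\<^sup>2) / (B * C * q * X))"
      unfolding P Q joukowski_def using nz X q0 by (simp add: field_simps power2_eq_square)
    thus ?thesis unfolding r_def D_def using nz X q0 gen CB
      by (simp add: power2_eq_square eval_nat_numeral mult_ac)
  qed
  \<comment> \<open>The recurrence times the common denominator, divided by \<open>1 - BCX\<close>.\<close>
  have poly: "- ((1 - B\<^sup>2 * q * X) * (C - B * X) * (1 - C\<^sup>2 * q * X\<^sup>2)) - (B - C * X) * D +
      (1 - B * C * q * X\<^sup>2) * (1 - B * C * q * X) * (B + C) * (1 - X) = 0"
    unfolding D_def by algebra
  have factor: "- M * u + - M * v + M * w = M * (- u - v + w)" for M u v w :: complex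
    by (simp add: algebra_simps)
  have "(joukowski Q - joukowski B) * P * s + (joukowski B - joukowski P) / Q + (joukowski P - joukowski Q) * B ^ 3 * q\<^sup>2 * r =
     (1 - B * C * X) / (B\<^sup>2 * C * q * X\<^sup>2 * D) *
     (- ((1 - B\<^sup>2 * q * X) * (C - B * X) * (1 - C\<^sup>2 * q * X\<^sup>2)) - (B - C * X) * D +
      (1 - B * C * q * X\<^sup>2) * (1 - B * C * q * X) * (B + C) * (1 - X))"
    unfolding c1 c0 c2 by (rule factor)
  hence zero: "(joukowski Q - joukowski B) * P * s + (joukowski B - joukowski P) / Q + (joukowski P - joukowski Q) * B ^ 3 * q\<^sup>2 * r = 0"
    unfolding poly by simp
  have "(joukowski Q - joukowski B) * P * (s * K) + (joukowski B - joukowski P) / Q * K +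
      (joukowski P - joukowski Q) * B ^ 3 * q\<^sup>2 * (r * K) =
     ((joukowski Q - joukowski B) * P * s + (joukowski B - joukowski P) / Q + (joukowski P - joukowski Q) * B ^ 3 * q\<^sup>2 * r) * K" for K
    by (simp only: distrib_right mult.assoc)
  thus ?thesis unfolding kS kr zero by simp
qed

text \<open>
  The condition on \<open>B\<^sup>2\<close> makes \<open>odd_theta q B\<close> and the leading coefficient of the recurrence nonzero;
  together with the condition on \<open>B\<close> and \<open>C\<close> it keeps those denominators in the ratios of the constants that
  involve \<open>B\<close> away from \<open>0\<close>. Both conditions are stable under the parameter shift of the recurrence.
\<close>

definition generic :: "complex \<Rightarrow> complex \<Rightarrow> complex \<Rightarrow> bool" where
  "generic q B C \<longleftrightarrow> (\<forall>m::int. B\<^sup>2 \<noteq> q powi m \<and> B \<noteq> C * q powi m)"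

lemma generic_shift:
  assumes "q \<noteq> 0" "generic q B C"
  shows "generic q (B * q\<^sup>2) (C * q)"
  unfolding generic_def
proof (intro allI conjI)
  fix m
  show "(B * q\<^sup>2)\<^sup>2 \<noteq> q powi m"
  proof
    assume "(B * q\<^sup>2)\<^sup>2 = q powi m"
    hence "B\<^sup>2 * q powi 4 = q powi m" by (simp add: power_mult_distrib)
    hence "B\<^sup>2 = q powi (m - 4)" using assms(1) by (simp add: power_int_diff field_simps)
    thus False using assms(2) by (auto simp: generic_def)
  qed
  show "B * q\<^sup>2 \<noteq> C * q * q powi m"
  proof
    assume "B * q\<^sup>2 = C * q * q powi m"
    hence "B = C * q powi (m - 1)"
      using assms(1) by (simp add: power_int_diff power2_eq_square field_simps)
    thus False using assms(2) by (auto simp: generic_def)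
  qed
qed

lemma generic_odd_theta:
  assumes "q \<noteq> 0" "norm q < 1" "B \<noteq> 0" "generic q B C"
  shows "odd_theta q B \<noteq> 0"
  using theta0_eq_0_iff[OF assms(2,1), of "B\<^sup>2"] assms by (auto simp: odd_theta_def generic_def)

text \<open>
  Strong induction over \<open>k\<close>: the recurrence expresses the value at \<open>k\<close> by those at \<open>k - 1\<close> and
  \<open>k - 2\<close>, the latter with shifted parameters.
\<close>

lemma kernel_sum_eq_theta_coeff:
  fixes q B C \<alpha> :: complex and k :: nat
  assumes q: "0 < norm q" "norm q < 1" and nz: "B \<noteq> 0" "C \<noteq> 0" "\<alpha> \<noteq> 0"
    and C: "\<And>i. i \<in> {1..k} \<Longrightarrow> C\<^sup>2 * q ^ i \<noteq> 1" and B: "generic q B C"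
  shows "kernel_sum q (int k) B C \<alpha> = theta_coeff q k B C * odd_theta q \<alpha>"
  using nz(1,2) C B
proof (induction k arbitrary: B C rule: less_induct)
  case (less k)
  note nz' = less.prems(1,2) and C = less.prems(3) and B = less.prems(4)
  have q0: "q \<noteq> 0" using q by auto
  have dB: "odd_theta q B \<noteq> 0" by (rule generic_odd_theta[OF q0 q(2) nz'(1) B])
  show ?case
  proof (cases k)
    case 0
    thus ?thesis using kernel_sum_0[OF q nz' nz(3) dB] by simp
  next
    case (Suc j)
    have IH1: "kernel_sum q (int j) B C \<alpha> = theta_coeff q j B C * odd_theta q \<alpha>"
      using Suc C by (intro less.IH nz' B) auto
    have IH2: "kernel_sum q (int j - 1) (B * q\<^sup>2) (C * q) \<alpha> =
        (if j = 0 then 0 else theta_coeff q (j - 1) (B * q\<^sup>2) (C * q)) * odd_theta q \<alpha>"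
    proof (cases j)
      case 0
      have "odd_theta q (B * q\<^sup>2) \<noteq> 0"
        using generic_odd_theta[OF q0 q(2) _ generic_shift[OF q0 B]] nz' q0 by simp
      thus ?thesis using kernel_sum_eq_0[OF q, of "B * q\<^sup>2" "C * q" \<alpha> "- 1"] nz nz' q0 0 by simp
    next
      case (Suc i)
      have "kernel_sum q (int i) (B * q\<^sup>2) (C * q) \<alpha> = theta_coeff q i (B * q\<^sup>2) (C * q) * odd_theta q \<alpha>"
      proof (rule less.IH)
        fix l assume l: "l \<in> {1..i}"
        have e: "(C * q)\<^sup>2 * q ^ l = C\<^sup>2 * q ^ (l + 2)" by (simp add: power2_eq_square mult_ac)
        show "(C * q)\<^sup>2 * q ^ l \<noteq> 1"
          unfolding e by (rule C) (use l Suc \<open>k = Suc j\<close> in auto)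
      qed (use Suc \<open>k = Suc j\<close> nz' q0 generic_shift[OF q0 B] in auto)
      thus ?thesis using Suc by simp
    qed
    have B1: "B\<^sup>2 * q ^ i \<noteq> 1" for i
    proof
      assume "B\<^sup>2 * q ^ i = 1"
      hence "B\<^sup>2 = q powi (- int i)" using q0 by (simp add: power_int_minus field_simps)
      thus False using B by (auto simp: generic_def)
    qed
    have B2: "B \<noteq> C" "B * q \<noteq> C"
    proof -
      show "B \<noteq> C" using B[unfolded generic_def, rule_format, of 0] by simp
      show "B * q \<noteq> C" using B[unfolded generic_def, rule_format, of "- 1"] q0
        by (auto simp: field_simps)
    qed
    define P where "P = C * q ^ j"
    define Q where "Q = B * q ^ (j + 1)"
    have PQ: "C * q powi int j = P" "B * q powi (int j + 1) = Q"
      using q0 by (simp_all add: P_def Q_def power_int_add)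
    define a where "a = (joukowski Q - joukowski B) * P"
    have "a * kernel_sum q (int j + 1) B C \<alpha> + (joukowski B - joukowski P) / Q * kernel_sum q (int j) B C \<alpha> +
      (joukowski P - joukowski Q) * B ^ 3 * q\<^sup>2 * kernel_sum q (int j - 1) (B * q\<^sup>2) (C * q) \<alpha> = 0"
      using kernel_sum_contiguous[OF q nz' nz(3), of "int j"] unfolding PQ a_def .
    hence 1: "a * kernel_sum q (int k) B C \<alpha> + ((joukowski B - joukowski P) / Q * theta_coeff q j B C +
      (joukowski P - joukowski Q) * B ^ 3 * q\<^sup>2 * (if j = 0 then 0 else theta_coeff q (j - 1) (B * q\<^sup>2) (C * q))) * odd_theta q \<alpha> = 0"
      unfolding IH1 IH2 Suc by (simp only: int_Suc distrib_right mult.assoc add.assoc)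
    have "a * theta_coeff q (Suc j) B C + (joukowski B - joukowski P) / Q * theta_coeff q j B C +
      (joukowski P - joukowski Q) * B ^ 3 * q\<^sup>2 * (if j = 0 then 0 else theta_coeff q (j - 1) (B * q\<^sup>2) (C * q)) = 0"
      unfolding a_def P_def Q_def
      by (rule theta_coeff_contiguous[OF q nz' _ B1 B2]) (use C Suc in auto)
    hence 2: "a * theta_coeff q k B C + ((joukowski B - joukowski P) / Q * theta_coeff q j B C +
      (joukowski P - joukowski Q) * B ^ 3 * q\<^sup>2 * (if j = 0 then 0 else theta_coeff q (j - 1) (B * q\<^sup>2) (C * q))) = 0"
      unfolding Suc by (simp only: add.assoc)
    have "a \<noteq> 0"
    proof -
      have "1 - q ^ (j + 1) \<noteq> 0" using power_neq_1[OF q(2), of "j + 1"] by simp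
      moreover have "1 - B\<^sup>2 * q ^ (j + 1) \<noteq> 0" using B1[of "j + 1"] by simp
      moreover have "joukowski Q - joukowski B = (1 - q ^ (j + 1)) * (1 - B\<^sup>2 * q ^ (j + 1)) / Q"
        unfolding Q_def joukowski_def using nz' q0 by (simp add: field_simps power2_eq_square)
      ultimately show ?thesis using nz' q0 by (simp add: a_def P_def Q_def)
    qed
    moreover have "a * kernel_sum q (int k) B C \<alpha> = a * (theta_coeff q k B C * odd_theta q \<alpha>)"
    proof -
      have "u = a * (v * d)" if "u + S * d = 0" "a * v + S = 0" for u v d S :: complex
        using that by algebra
      thus ?thesis using 1 2 by blast
    qed
    ultimately show ?thesis by simp
  qed
qed

section \<open>Arbitrary parameters\<close>

text \<open>
  The set where \<open>f\<close> and \<open>g\<close> differ is open, and a nonempty open set is not countable.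
\<close>

lemma continuous_eq_off_countable:
  fixes f g :: "complex \<Rightarrow> complex"
  assumes "open S" "continuous_on S f" "continuous_on S g" "countable N"
    and eq: "\<And>z. z \<in> S - N \<Longrightarrow> f z = g z" and z: "z \<in> S"
  shows "f z = g z"
proof (rule ccontr)
  assume ne: "f z \<noteq> g z"
  have "open (S \<inter> (\<lambda>w. f w - g w) -` (- {0}))"
    using assms(1-3) by (intro continuous_open_preimage continuous_intros) auto
  moreover have "z \<in> S \<inter> (\<lambda>w. f w - g w) -` (- {0})" using ne z by simp
  ultimately obtain e where e: "e > 0" "ball z e \<subseteq> S \<inter> (\<lambda>w. f w - g w) -` (- {0})"
    by (rule openE)
  have "w \<in> N" if "w \<in> ball z e" for w
    using subsetD[OF e(2) that] eq[of w] by auto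
  hence "ball z e \<subseteq> N" by blast
  hence "countable (ball z e)" using assms(4) countable_subset by blast
  thus False using uncountable_ball[OF e(1)] by blast
qed

lemma countable_non_generic: "countable {B. \<not> generic q B C}"
proof -
  have eq: "{B. \<not> generic q B C} =
      (\<Union>m\<in>(UNIV :: int set). {B. B\<^sup>2 = q powi m} \<union> {C * q powi m})"
    by (auto simp: generic_def)
  have fin: "finite {B. B\<^sup>2 = c}" for c :: complex
  proof -
    have "{B. B\<^sup>2 = c} \<subseteq> {csqrt c, - csqrt c}"
      using power2_eq_iff[of _ "csqrt c"] by auto
    thus ?thesis using finite_subset by blast
  qed
  show ?thesis
    unfolding eq by (intro countable_UN countableI_type countable_finite finite_UnI fin) auto
qed

lemma kernel_sum_continuous_B:
  assumes q: "0 < norm q" "norm q < 1" and nz: "C \<noteq> 0" "\<alpha> \<noteq> 0"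
  shows "continuous_on (- {0}) (\<lambda>B. kernel_sum q k B C \<alpha>)"
proof -
  have "(\<lambda>B. kernel_sum q k B C \<alpha>) holomorphic_on - {0}"
    by (rule kernel_sum_holomorphic[OF q nz(1), where \<alpha> = "\<lambda>_. \<alpha>" and B = "\<lambda>B. B"])
      (use nz in auto)
  thus ?thesis by (rule holomorphic_on_imp_continuous_on)
qed

lemma theta_coeff_continuous_B:
  assumes q: "0 < norm q" "norm q < 1" and "C \<noteq> 0"
  shows "continuous_on (- {0}) (\<lambda>B. theta_coeff q k B C)"
proof -
  have q2: "norm (q\<^sup>2) < 1" using q by (simp add: norm_power power_less_one_iff)
  show ?thesis
    unfolding theta_coeff_def qpoch_of_nat divide_inverse[of "\<Prod>j<k. _ j"] using assms q2
    by (intro continuous_intros) auto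
qed

lemma kernel_sum_evaluation:
  fixes q B C \<alpha> :: complex
  assumes q: "0 < norm q" "norm q < 1" and nz: "B \<noteq> 0" "C \<noteq> 0" "\<alpha> \<noteq> 0"
    and C: "\<And>i. i \<in> {1..k} \<Longrightarrow> C\<^sup>2 * q ^ i \<noteq> 1"
  shows "kernel_sum q (int k) B C \<alpha> = theta_coeff q k B C * odd_theta q \<alpha>"
proof (rule continuous_eq_off_countable[where S = "- {0}" and N = "{B. \<not> generic q B C}" and
      f = "\<lambda>B. kernel_sum q (int k) B C \<alpha>" and g = "\<lambda>B. theta_coeff q k B C * odd_theta q \<alpha>"])
  show "continuous_on (- {0}) (\<lambda>B. kernel_sum q (int k) B C \<alpha>)"
    by (rule kernel_sum_continuous_B[OF q nz(2,3)])
  show "continuous_on (- {0}) (\<lambda>B. theta_coeff q k B C * odd_theta q \<alpha>)"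
    by (intro continuous_intros theta_coeff_continuous_B q nz)
  show "kernel_sum q (int k) z C \<alpha> = theta_coeff q k z C * odd_theta q \<alpha>"
    if "z \<in> - {0} - {B. \<not> generic q B C}" for z
    using that by (intro kernel_sum_eq_theta_coeff q nz C) auto
qed (use nz countable_non_generic in auto)

lemma kernel_sum_negative:
  fixes q B C \<alpha> :: complex
  assumes q: "0 < norm q" "norm q < 1" and nz: "B \<noteq> 0" "C \<noteq> 0" "\<alpha> \<noteq> 0" and k: "k < 0"
  shows "kernel_sum q k B C \<alpha> = 0"
proof (rule continuous_eq_off_countable[where S = "- {0}" and N = "{B. \<not> generic q B C}" and
      f = "\<lambda>B. kernel_sum q k B C \<alpha>" and g = "\<lambda>_. 0"])
  show "continuous_on (- {0}) (\<lambda>B. kernel_sum q k B C \<alpha>)"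
    by (rule kernel_sum_continuous_B[OF q nz(2,3)])
  show "kernel_sum q k z C \<alpha> = 0" if "z \<in> - {0} - {B. \<not> generic q B C}" for z
    using that q generic_odd_theta[of q z C] by (intro kernel_sum_eq_0 q nz k) auto
qed (use nz countable_non_generic in auto)

text \<open>
  Up to the factor \<open>\<alpha> - 1/\<alpha>\<close>, the constant that clears the denominators of the summand. It
  consists of the infinite products in base \<open>q\<close> that the kernel contains at \<open>x = \<alpha>\<close>.
\<close>

definition normalizer :: "complex \<Rightarrow> complex \<Rightarrow> complex \<Rightarrow> complex \<Rightarrow> int \<Rightarrow> complex" where
  "normalizer q a b c k = qpochs_inf [a * q powi (1 - k) / c, q powi (1 - k) / c,
     b * q powi (1 + k), b * q powi (1 + k) / a, a * q / b, q / b] q"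

lemma summand_eq_kernel_term:
  fixes q a b c \<alpha> :: complex and k n :: int
  assumes q: "0 < norm q" "norm q < 1" and nz: "a \<noteq> 0" "b \<noteq> 0" "c \<noteq> 0" "1 - a \<noteq> 0"
    and def: "\<And>n :: int. qpoch_ratio_defined
          [b, c * q powi k, a * q powi (- k) / b]
          [a * q / b, a * q powi (1 - k) / c, b * q powi (1 + k)] q n"
    and \<alpha>: "\<alpha>\<^sup>2 = a"
  shows "(1 - a * q powi (2 * n)) / (1 - a)
            * (qpochs [b, c * q powi k, a * q powi (- k) / b] q n
               / qpochs [a * q / b, a * q powi (1 - k) / c, b * q powi (1 + k)] q n)
            * q powi (n * (n - 1) div 2)
            * (- (a * q / c)) powi n
            * qpochs_inf [b * q powi (1 + n), b * q powi (1 - n) / a,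
                          c^2 * q powi (2 + n) / b, c^2 * q powi (2 - n) / (a * b)] (q^2)
         * ((\<alpha> - 1 / \<alpha>) * normalizer q a b c k) = kernel_term q k (b / \<alpha>) (c / \<alpha>) \<alpha> n"
proof -
  have q0: "q \<noteq> 0" using q by auto
  have \<alpha>0: "\<alpha> \<noteq> 0" using \<alpha> nz by auto
  have aa: "\<alpha> * \<alpha> = a" using \<alpha> by (simp add: power2_eq_square)
  have den: "1 - y * q powi j \<noteq> 0"
    if "y \<in> {a * q / b, a * q powi (1 - k) / c, b * q powi (1 + k)}" "j \<ge> 0" for y and j :: int
    using def[of "j + 1"] that unfolding qpoch_ratio_defined_def by auto
  have num: "1 - y * q powi (- j) \<noteq> 0"
    if "y \<in> {b, c * q powi k, a * q powi (- k) / b}" "j \<ge> 1" for y and j :: int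
    using def[of "- j"] that unfolding qpoch_ratio_defined_def by auto
  have shift: "qpoch_inf (y * q powi n) q = qpoch_inf y q / qpoch y q n"
    if "y \<in> {a * q / b, a * q powi (1 - k) / c, b * q powi (1 + k)}" for y
    using den[OF that] by (intro qpoch_inf_shift q0 q qpoch_nonzero) auto
  have reflect: "qpoch_inf (q powi (1 - n) / y) q =
      qpoch_inf (q / y) q * qpoch y q n * (- 1 / y) powi n * q powi (- binom2 n)"
    if "y \<in> {b, c * q powi k, a * q powi (- k) / b}" for y
    using num[OF that] that nz q0 by (intro qpoch_inf_reflect q0 q) auto
  define x where "x = \<alpha> * q powi n"
  define N1 where "N1 = qpoch b q n"
  define N2 where "N2 = qpoch (c * q powi k) q n"
  define N3 where "N3 = qpoch (a * q powi (- k) / b) q n"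
  define D1 where "D1 = qpoch (a * q / b) q n"
  define D2 where "D2 = qpoch (a * q powi (1 - k) / c) q n"
  define D3 where "D3 = qpoch (b * q powi (1 + k)) q n"
  define I where "I = qpochs_inf [b * q powi (1 + n), b * q powi (1 - n) / a,
                          c^2 * q powi (2 + n) / b, c^2 * q powi (2 - n) / (a * b)] (q^2)"
  have i1: "qpoch_sym (b / \<alpha> * q) x (q\<^sup>2) * qpoch_sym ((c / \<alpha>)\<^sup>2 * q\<^sup>2 / (b / \<alpha>)) x (q\<^sup>2) = I"
  proof -
    have e1: "b / \<alpha> * q * x = b * q powi (1 + n)"
      using \<alpha>0 q0 by (simp add: x_def power_int_add)
    have e2: "b / \<alpha> * q / x = b * q powi (1 - n) / a"
      using \<alpha>0 q0 nz by (simp add: x_def power_int_diff aa[symmetric] field_simps)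
    have e3: "(c / \<alpha>)\<^sup>2 * q\<^sup>2 / (b / \<alpha>) * x = c^2 * q powi (2 + n) / b"
      using \<alpha>0 q0 nz by (simp add: x_def power_int_add power2_eq_square field_simps)
    have e4: "(c / \<alpha>)\<^sup>2 * q\<^sup>2 / (b / \<alpha>) / x = c^2 * q powi (2 - n) / (a * b)"
      using \<alpha>0 q0 nz by (simp add: x_def power_int_diff aa[symmetric] power2_eq_square field_simps)
    show ?thesis unfolding qpoch_sym_def e1 e2 e3 e4 I_def qpochs_inf_def by (simp add: mult.assoc)
  qed
  have i2: "qpoch_sym (q powi (1 - k) / (c / \<alpha>)) x q =
     qpoch_inf (a * q powi (1 - k) / c) q / D2 *
     (qpoch_inf (q powi (1 - k) / c) q * N2 * (- 1 / (c * q powi k)) powi n * q powi (- binom2 n))"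
  proof -
    have e1: "q powi (1 - k) / (c / \<alpha>) * x = a * q powi (1 - k) / c * q powi n"
      using nz by (simp add: x_def aa[symmetric] field_simps)
    have e2: "q powi (1 - k) / (c / \<alpha>) / x = q powi (1 - n) / (c * q powi k)"
      using \<alpha>0 q0 nz by (simp add: x_def power_int_diff field_simps)
    have e3: "q / (c * q powi k) = q powi (1 - k) / c"
      using q0 by (simp add: power_int_diff)
    have s: "qpoch_inf (a * q powi (1 - k) / c * q powi n) q = qpoch_inf (a * q powi (1 - k) / c) q / qpoch (a * q powi (1 - k) / c) q n"
      by (rule shift) simp
    have r: "qpoch_inf (q powi (1 - n) / (c * q powi k)) q = qpoch_inf (q / (c * q powi k)) q * qpoch (c * q powi k) q n *
        (- 1 / (c * q powi k)) powi n * q powi (- binom2 n)"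
      by (rule reflect) simp
    show ?thesis unfolding qpoch_sym_def e1 e2 s r e3 N2_def D2_def ..
  qed
  have i3: "qpoch_sym (b / \<alpha> * q powi (k + 1)) x q =
     qpoch_inf (b * q powi (1 + k)) q / D3 *
     (qpoch_inf (b * q powi (1 + k) / a) q * N3 * (- 1 / (a * q powi (- k) / b)) powi n * q powi (- binom2 n))"
  proof -
    have e1: "b / \<alpha> * q powi (k + 1) * x = b * q powi (1 + k) * q powi n"
      using \<alpha>0 by (simp add: x_def add.commute)
    have e2: "b / \<alpha> * q powi (k + 1) / x = q powi (1 - n) / (a * q powi (- k) / b)"
      using \<alpha>0 q0 nz by (simp add: x_def power_int_diff power_int_add power_int_minus aa[symmetric] field_simps)
    have e3: "q / (a * q powi (- k) / b) = b * q powi (1 + k) / a"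
      using q0 nz by (simp add: power_int_add power_int_minus field_simps)
    have s: "qpoch_inf (b * q powi (1 + k) * q powi n) q = qpoch_inf (b * q powi (1 + k)) q / qpoch (b * q powi (1 + k)) q n"
      by (rule shift) simp
    have r: "qpoch_inf (q powi (1 - n) / (a * q powi (- k) / b)) q = qpoch_inf (q / (a * q powi (- k) / b)) q * qpoch (a * q powi (- k) / b) q n *
        (- 1 / (a * q powi (- k) / b)) powi n * q powi (- binom2 n)"
      by (rule reflect) simp
    show ?thesis unfolding qpoch_sym_def e1 e2 s r e3 N3_def D3_def ..
  qed
  have i4: "qpoch_sym (q / (b / \<alpha>)) x q =
     qpoch_inf (a * q / b) q / D1 * (qpoch_inf (q / b) q * N1 * (- 1 / b) powi n * q powi (- binom2 n))"
  proof -
    have e1: "q / (b / \<alpha>) * x = a * q / b * q powi n"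
      using nz by (simp add: x_def aa[symmetric] field_simps)
    have e2: "q / (b / \<alpha>) / x = q powi (1 - n) / b"
      using \<alpha>0 q0 nz by (simp add: x_def power_int_diff field_simps)
    have s: "qpoch_inf (a * q / b * q powi n) q = qpoch_inf (a * q / b) q / qpoch (a * q / b) q n"
      by (rule shift) simp
    have r: "qpoch_inf (q powi (1 - n) / (b)) q = qpoch_inf (q / (b)) q * qpoch (b) q n *
        (- 1 / (b)) powi n * q powi (- binom2 n)"
      by (rule reflect) simp
    show ?thesis unfolding qpoch_sym_def e1 e2 s r  N1_def D1_def ..
  qed
  \<comment> \<open>All powers of \<open>q\<close> and of the parameters combine to the prefactors of the summand.\<close>
  have mono: "\<alpha> powi (4 * n) * q powi (2 * n\<^sup>2) * (x - 1 / x) *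
      ((- 1 / (c * q powi k)) powi n * (- 1 / (a * q powi (- k) / b)) powi n * (- 1 / b) powi n *
       (q powi (- binom2 n) * q powi (- binom2 n) * q powi (- binom2 n))) =
      (1 - a * q powi (2 * n)) / (1 - a) * (\<alpha> - 1 / \<alpha>) * q powi (binom2 n) * (- (a * q / c)) powi n"
  proof -
    have m1: "(- 1 / (c * q powi k)) powi n * (- 1 / (a * q powi (- k) / b)) powi n * (- 1 / b) powi n =
        (- 1 / (a * c)) powi n"
    proof -
      have "- 1 / (c * q powi k) * (- 1 / (a * q powi (- k) / b)) * (- 1 / b) = - 1 / (a * c)"
        using nz q0 by (simp add: power_int_minus field_simps)
      thus ?thesis by (simp only: power_int_mult_distrib[symmetric])
    qed
    have m2: "\<alpha> powi (4 * n) = (a * a) powi n"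
    proof -
      have "\<alpha> powi (4 * n) = (\<alpha> powi 4) powi n" by (rule power_int_mult)
      also have "\<alpha> powi 4 = a * a" by (simp add: aa[symmetric] eval_nat_numeral)
      finally show ?thesis .
    qed
    have "(a * a) powi n * (- 1 / (a * c)) powi n = (- (a / c)) powi n"
      using nz by (subst power_int_mult_distrib[symmetric]) simp
    moreover have "(- (a * q / c)) powi n = (- (a / c)) powi n * q powi n"
      by (subst power_int_mult_distrib[symmetric]) simp
    moreover have "x - 1 / x = (1 - a * q powi (2 * n)) / (1 - a) * (\<alpha> - 1 / \<alpha>) * q powi (- n)"
    proof -
      have q2n: "q powi (2 * n) = q powi n * q powi n"
        using q0 by (simp add: power_int_add[symmetric])
      have e: "\<alpha> - 1 / \<alpha> = - (1 - a) / \<alpha>" using \<alpha>0 by (simp add: aa[symmetric] field_simps)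
      have cancel: "u / v * (- v / w) = - u / w" if "v \<noteq> 0" for u v w :: complex
        using that by simp
      have "(1 - a * q powi (2 * n)) / (1 - a) * (\<alpha> - 1 / \<alpha>) * q powi (- n) =
          - (1 - a * q powi (2 * n)) / (\<alpha> * q powi n)"
        unfolding e cancel[OF nz(4)] by (simp add: power_int_minus divide_inverse)
      also have "\<dots> = x - 1 / x"
        unfolding x_def q2n using \<alpha>0 q0 by (simp add: aa[symmetric] field_simps)
      finally show ?thesis by simp
    qed
    moreover have "q powi (2 * n\<^sup>2) * q powi (- n) * (q powi (- binom2 n) * q powi (- binom2 n) * q powi (- binom2 n)) =
        q powi (binom2 n) * q powi n"
    proof -
      have "2 * n\<^sup>2 + (- n) + (- binom2 n + - binom2 n + - binom2 n) = binom2 n + n"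
        using two_binom2[of n] by (simp add: power2_eq_square algebra_simps)
      thus ?thesis using q0 by (simp add: power_int_add[symmetric])
    qed
    ultimately show ?thesis unfolding m1 m2
      by (smt (verit, del_insts) mult.assoc mult.left_commute mult.commute)
  qed
  have "kernel_term q k (b / \<alpha>) (c / \<alpha>) \<alpha> n =
     \<alpha> powi (4 * n) * q powi (2 * n\<^sup>2) * (x - 1 / x) *
      ((- 1 / (c * q powi k)) powi n * (- 1 / (a * q powi (- k) / b)) powi n * (- 1 / b) powi n *
       (q powi (- binom2 n) * q powi (- binom2 n) * q powi (- binom2 n))) *
     (I * (N1 * N2 * N3 / (D1 * D2 * D3)) * normalizer q a b c k)"
    unfolding kernel_term_def kernel_def x_def[symmetric] i2 i3 i4 i1[symmetric] normalizer_def qpochs_inf_def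
    by (simp add: divide_inverse mult_ac)
  also have "\<dots> = (1 - a * q powi (2 * n)) / (1 - a) * (\<alpha> - 1 / \<alpha>) * q powi (binom2 n) * (- (a * q / c)) powi n *
     (I * (N1 * N2 * N3 / (D1 * D2 * D3)) * normalizer q a b c k)"
    unfolding mono ..
  finally show ?thesis
    unfolding I_def[symmetric] qpochs_def N1_def N2_def N3_def D1_def D2_def D3_def binom2_def
    by (simp add: mult_ac)
qed


text \<open>
  After rewriting the shifted infinite products in \<open>normalizer\<close> and \<open>theta_coeff\<close> in terms of unshifted ones, both
  sides consist of the same factors. The monomials agree because
  \<open>(-c/b) (-a/c) (-1/c) = -a/(bc)\<close>.
\<close>

lemma value_eq_theta_coeff:
  fixes q a b c \<alpha> :: complex and k :: nat
  assumes q: "0 < norm q" "norm q < 1" and nz: "a \<noteq> 0" "b \<noteq> 0" "c \<noteq> 0"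
    and def1: "qpoch_ratio_defined [b * c / a, b * q, b * q / a, b / c]
          [q, c / a, c, c^2 * q / a] q (int k)"
    and def2: "qpoch_ratio_defined [c^2 * q / a] [b^2 * q / a] (q^2) (int k)"
    and def3: "qpochs_inf [b * q, q / b, b * q / a, a * q / b, q / c, a * q / c] q \<noteq> 0"
    and \<alpha>: "\<alpha>\<^sup>2 = a"
  shows "(qpochs [b * c / a, b * q, b * q / a, b / c] q (int k)
             / qpochs [q, c / a, c, c^2 * q / a] q (int k)
           * (qpoch (c^2 * q / a) (q^2) (int k) / qpoch (b^2 * q / a) (q^2) (int k))
           * (- (c / b)) powi (int k)
           * (qpochs_inf [q, q, a * q, q / a, a * q / (b * c), b * q / c] q
              / qpochs_inf [b * q, q / b, b * q / a, a * q / b, q / c, a * q / c] q)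
           * qpochs_inf [q, b^2 * q / a, c^2 * q^2 / a, c^2 * q^2 / b^2] (q^2))
         * ((\<alpha> - 1 / \<alpha>) * normalizer q a b c (int k)) = theta_coeff q k (b / \<alpha>) (c / \<alpha>) * odd_theta q \<alpha>"
proof -
  have q0: "q \<noteq> 0" using q by auto
  have q2: "norm (q\<^sup>2) < 1" using q by (simp add: norm_power power_less_one_iff)
  have \<alpha>0: "\<alpha> \<noteq> 0" using \<alpha> nz by auto
  have aa: "\<alpha> * \<alpha> = a" using \<alpha> by (simp add: power2_eq_square)
  define K where "K = int k"
  have K0: "K \<ge> 0" by (simp add: K_def)
  have inf0: "qpoch_inf (b * q) q \<noteq> 0" "qpoch_inf (q / b) q \<noteq> 0" "qpoch_inf (b * q / a) q \<noteq> 0"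
      "qpoch_inf (a * q / b) q \<noteq> 0" "qpoch_inf (q / c) q \<noteq> 0" "qpoch_inf (a * q / c) q \<noteq> 0"
    using def3 by (auto simp: qpochs_inf_def)
  have fin0: "qpoch y q K \<noteq> 0" if "y \<in> {q, c / a, c, c^2 * q / a}" for y
    using def1 that K0 unfolding qpoch_ratio_defined_def K_def by (intro qpoch_nonzero) auto
  have fin1: "qpoch (b^2 * q / a) (q^2) K \<noteq> 0"
    using def2 K0 unfolding qpoch_ratio_defined_def K_def by (intro qpoch_nonzero) auto
  have fin2: "qpoch y q K \<noteq> 0" if "qpoch_inf y q \<noteq> 0" for y
  proof (rule qpoch_nonzero[OF _ K0])
    fix j assume "j \<in> {0..<K}"
    thus "1 - y * q powi j \<noteq> 0"
      using that qpoch_inf_eq_0_iff[OF q(2), of y] by (auto simp: power_int_def)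
  qed
  have shift: "qpoch_inf (y * q powi K) q = qpoch_inf y q / qpoch y q K" if "qpoch_inf y q \<noteq> 0" for y
    using fin2[OF that] by (intro qpoch_inf_shift q0 q) auto
  have reflect: "qpoch_inf (q powi (1 - K) / y) q =
      qpoch_inf (q / y) q * qpoch y q K * (- 1 / y) powi K * q powi (- binom2 K)" if "y \<noteq> 0" for y
    using that K0 by (intro qpoch_inf_reflect q0 q) auto
  have w1: "qpoch_inf (a * q powi (1 - K) / c) q =
      qpoch_inf (a * q / c) q * qpoch (c / a) q K * (- 1 / (c / a)) powi K * q powi (- binom2 K)"
  proof -
    have e: "a * q powi (1 - K) / c = q powi (1 - K) / (c / a)" "a * q / c = q / (c / a)"
      using nz by simp_all
    show ?thesis unfolding e by (rule reflect) (use nz in simp)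
  qed
  have w2: "qpoch_inf (q powi (1 - K) / c) q =
      qpoch_inf (q / c) q * qpoch c q K * (- 1 / c) powi K * q powi (- binom2 K)"
    by (rule reflect) (rule nz)
  have w3: "qpoch_inf (b * q powi (1 + K)) q = qpoch_inf (b * q) q / qpoch (b * q) q K"
    using shift[OF inf0(1)] q0 by (simp add: power_int_add mult_ac)
  have w4: "qpoch_inf (b * q powi (1 + K) / a) q = qpoch_inf (b * q / a) q / qpoch (b * q / a) q K"
    using shift[OF inf0(3)] q0 by (simp add: power_int_add mult_ac)
  have B: "b / \<alpha> * (c / \<alpha>) = b * c / a" "b / \<alpha> / (c / \<alpha>) = b / c" "b / \<alpha> * q / (c / \<alpha>) = b * q / c"
    "(c / \<alpha>)\<^sup>2 * q\<^sup>2 / (b / \<alpha>)\<^sup>2 = c^2 * q^2 / b^2" "(c / \<alpha>)\<^sup>2 * q = c^2 * q / a"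
    "(c / \<alpha>)\<^sup>2 * q\<^sup>2 = c^2 * q^2 / a" "c^2 * q^2 / a / (b / \<alpha>)\<^sup>2 = c^2 * q^2 / b^2"
    using \<alpha>0 nz by (simp_all add: aa power_divide \<alpha>)
  have k1: "qpoch_inf (q powi (1 - K) / (b * c / a)) q =
      qpoch_inf (a * q / (b * c)) q * qpoch (b * c / a) q K * (- 1 / (b * c / a)) powi K * q powi (- binom2 K)"
  proof -
    have e: "a * q / (b * c) = q / (b * c / a)" using nz by simp
    show ?thesis unfolding e by (rule reflect) (use nz in simp)
  qed
  have k2: "qpoch_inf ((b / \<alpha>)\<^sup>2 * q ^ (2 * k + 1)) (q\<^sup>2) =
      qpoch_inf (b^2 * q / a) (q^2) / qpoch (b^2 * q / a) (q^2) K"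
  proof -
    have e: "(b / \<alpha>)\<^sup>2 * q ^ (2 * k + 1) = b^2 * q / a * (q^2) powi K"
      by (simp add: power_divide \<alpha> K_def power_mult[symmetric])
    show ?thesis unfolding e using fin1 q0 by (intro qpoch_inf_shift q2) auto
  qed
  have mono: "(- 1 / (b * c / a)) powi K =
      (- (c / b)) powi K * (- 1 / (c / a)) powi K * (- 1 / c) powi K"
  proof -
    have "- 1 / (b * c / a) = - (c / b) * (- 1 / (c / a)) * (- 1 / c)"
      using nz by (simp add: field_simps)
    thus ?thesis by (simp only: power_int_mult_distrib)
  qed
  have psi: "odd_theta q \<alpha> = (\<alpha> - 1 / \<alpha>) * (qpoch_inf (a * q) q * qpoch_inf (q / a) q)"
    using odd_theta_eq[OF q(2) \<alpha>0] by (simp add: \<alpha>)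
  show ?thesis
    unfolding theta_coeff_def psi normalizer_def K_def[symmetric] B k2 k1 mono qpochs_inf_def qpochs_def
    using inf0 fin0[of q] fin0[of "c / a"] fin0[of c] fin0[of "c^2 * q / a"] fin1
      fin2[OF inf0(1)] fin2[OF inf0(3)]
    by (simp add: w1 w2 w3 w4 power2_eq_square[of "qpoch_inf q q"] mult_ac)
qed

theorem theorem4p2:
  fixes q a b c :: complex and k :: int
  assumes q: "0 < norm q" "norm q < 1"
    and nz: "a \<noteq> 0" "b \<noteq> 0" "c \<noteq> 0" "1 - a \<noteq> 0"
    and lhs_def: "\<And>n :: int. qpoch_ratio_defined
          [b, c * q powi k, a * q powi (- k) / b]
          [a * q / b, a * q powi (1 - k) / c, b * q powi (1 + k)] q n"
    and rhs_def1: "qpoch_ratio_defined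
          [b * c / a, b * q, b * q / a, b / c]
          [q, c / a, c, c^2 * q / a] q k"
    and rhs_def2: "qpoch_ratio_defined [c^2 * q / a] [b^2 * q / a] (q^2) k"
    and rhs_def3: "qpochs_inf [b * q, q / b, b * q / a, a * q / b, q / c, a * q / c] q \<noteq> 0"
  shows "((\<lambda>n :: int.
            (1 - a * q powi (2 * n)) / (1 - a)
            * (qpochs [b, c * q powi k, a * q powi (- k) / b] q n
               / qpochs [a * q / b, a * q powi (1 - k) / c, b * q powi (1 + k)] q n)
            * q powi (n * (n - 1) div 2)
            * (- (a * q / c)) powi n
            * qpochs_inf [b * q powi (1 + n), b * q powi (1 - n) / a,
                          c^2 * q powi (2 + n) / b, c^2 * q powi (2 - n) / (a * b)] (q^2))
          has_sum
          (qpochs [b * c / a, b * q, b * q / a, b / c] q k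
             / qpochs [q, c / a, c, c^2 * q / a] q k
           * (qpoch (c^2 * q / a) (q^2) k / qpoch (b^2 * q / a) (q^2) k)
           * (- (c / b)) powi k
           * (qpochs_inf [q, q, a * q, q / a, a * q / (b * c), b * q / c] q
              / qpochs_inf [b * q, q / b, b * q / a, a * q / b, q / c, a * q / c] q)
           * qpochs_inf [q, b^2 * q / a, c^2 * q^2 / a, c^2 * q^2 / b^2] (q^2)))
         UNIV"
    (is "(?f has_sum ?S) UNIV")
proof -
  have q0: "q \<noteq> 0" using q by auto
  define \<alpha> where "\<alpha> = csqrt a"
  have \<alpha>: "\<alpha>\<^sup>2 = a" by (simp add: \<alpha>_def)
  have \<alpha>0: "\<alpha> \<noteq> 0" using \<alpha> nz by auto
  define W where "W = (\<alpha> - 1 / \<alpha>) * normalizer q a b c k"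
  have den: "1 - y * q powi j \<noteq> 0"
    if "y \<in> {a * q / b, a * q powi (1 - k) / c, b * q powi (1 + k)}" "j \<ge> 0" for y and j :: int
    using lhs_def[of "j + 1"] that unfolding qpoch_ratio_defined_def by auto
  have num: "1 - y * q powi (- j) \<noteq> 0"
    if "y \<in> {b, c * q powi k, a * q powi (- k) / b}" "j \<ge> 1" for y and j :: int
    using lhs_def[of "- j"] that unfolding qpoch_ratio_defined_def by auto
  have den_inf: "qpoch_inf y q \<noteq> 0"
    if "y \<in> {a * q / b, a * q powi (1 - k) / c, b * q powi (1 + k)}" for y
    using den[OF that] by (intro qpoch_inf_nonzero q) auto
  have num_inf: "qpoch_inf (q / y) q \<noteq> 0"
    if y: "y \<in> {b, c * q powi k, a * q powi (- k) / b}" for y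
  proof (rule qpoch_inf_nonzero[OF q(2)])
    fix j :: int assume j: "j \<ge> 0"
    have y0: "y \<noteq> 0" using y nz q0 by auto
    have "1 - y * q powi (- (j + 1)) \<noteq> 0" by (rule num[OF y]) (use j in simp)
    moreover have "q powi (- (j + 1)) = 1 / (q * q powi j)"
      unfolding power_int_minus using q0 by (simp add: power_int_add divide_inverse mult_ac)
    ultimately show "1 - q / y * q powi j \<noteq> 0"
      using y0 q0 by (auto simp: field_simps)
  qed
  have "normalizer q a b c k \<noteq> 0"
  proof -
    have "q / (c * q powi k) = q powi (1 - k) / c"
      using q0 by (simp add: power_int_diff)
    moreover have "q / (a * q powi (- k) / b) = b * q powi (1 + k) / a"
      using q0 nz by (simp add: power_int_add power_int_minus field_simps)
    ultimately show ?thesis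
      using den_inf num_inf[of b] num_inf[of "c * q powi k"] num_inf[of "a * q powi (- k) / b"]
      by (simp add: normalizer_def qpochs_inf_def)
  qed
  moreover have "\<alpha> - 1 / \<alpha> \<noteq> 0"
    using nz \<alpha> \<alpha>0 by (auto simp: field_simps power2_eq_square)
  ultimately have W: "W \<noteq> 0" by (simp add: W_def)
  have move: "u = v * inverse w" if "u * w = v" "w \<noteq> 0" for u v w :: complex
    using that by auto
  have "?f n = kernel_term q k (b / \<alpha>) (c / \<alpha>) \<alpha> n * inverse W" for n
    by (rule move[OF _ W], unfold W_def, rule summand_eq_kernel_term[OF q nz lhs_def \<alpha>])
  moreover have "?S = kernel_sum q k (b / \<alpha>) (c / \<alpha>) \<alpha> * inverse W"
  proof (cases "k \<ge> 0")
    case True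
    then obtain l where l: "k = int l" using zero_le_imp_eq_int by blast
    have "(c / \<alpha>)\<^sup>2 * q ^ i \<noteq> 1" if i: "i \<in> {1..l}" for i
    proof -
      obtain j where j: "i = Suc j" "j < l" using i by (cases i) auto
      have "1 - c^2 * q / a * q powi (int j) \<noteq> 0"
      proof -
        have "\<forall>y\<in>set [q, c / a, c, c^2 * q / a]. \<forall>j\<in>{0..<k}. 1 - y * q powi j \<noteq> 0"
          using rhs_def1 unfolding qpoch_ratio_defined_def by blast
        moreover have "c^2 * q / a \<in> set [q, c / a, c, c^2 * q / a]" "int j \<in> {0..<k}"
          using j(2) l by auto
        ultimately show ?thesis by blast
      qed
      thus ?thesis by (simp add: j(1) power_divide \<alpha> mult.assoc)
    qed
    hence "kernel_sum q k (b / \<alpha>) (c / \<alpha>) \<alpha> = theta_coeff q l (b / \<alpha>) (c / \<alpha>) * odd_theta q \<alpha>"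
      unfolding l using nz \<alpha>0 by (intro kernel_sum_evaluation q) auto
    also have "\<dots> = ?S * W"
      unfolding W_def l using value_eq_theta_coeff[OF q nz(1-3) _ _ rhs_def3 \<alpha>, of l] rhs_def1 rhs_def2
      unfolding l by simp
    finally show ?thesis using W by simp
  next
    case False
    have "qpoch q q k = 0"
    proof -
      have "inverse (1 - q * q powi (- int 1)) = 0" using q0 by (simp add: power_int_minus)
      moreover have "1 \<in> {1..nat (- k)}" using False by auto
      ultimately have "(\<Prod>j=1..nat (- k). inverse (1 - q * q powi (- int j))) = 0"
        by (meson finite_atLeastAtMost prod_zero)
      thus ?thesis using False by (simp add: qpoch_def)
    qed
    hence "?S = 0" by (simp add: qpochs_def)
    moreover have "kernel_sum q k (b / \<alpha>) (c / \<alpha>) \<alpha> = 0"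
      using nz \<alpha>0 False by (intro kernel_sum_negative q) auto
    ultimately show ?thesis by simp
  qed
  moreover have "((\<lambda>n. kernel_term q k (b / \<alpha>) (c / \<alpha>) \<alpha> n * inverse W) has_sum
      kernel_sum q k (b / \<alpha>) (c / \<alpha>) \<alpha> * inverse W) UNIV"
    using nz \<alpha>0 by (intro has_sum_cmult_left kernel_term_has_sum q) auto
  ultimately show ?thesis by (simp only:)
qed

end
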